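(* Suppose that a Banach space $X$ with a Schauder basis $(e_i)$ contains a subspace $Y$ which admits an equivalent almost transitive norm. If $(e_i)$ satisfies $(p,q)$-estimates, where $1<q\le p<\infty$, then $q\le2\le p$.
   Context: Banach spaces are infinite-dimensional, real or complex, and "subspace" means closed infinite-dimensional linear subspace. A norm on $Y$ is almost transitive if for every $y$ in the unit sphere of $Y$ the orbit of $y$ under the group of surjective linear isometries of $Y$ (for that norm) is norm dense in the unit sphere. For vectors $x,y\in X$, $x<y$ means $\max\operatorname{supp}x<\min\operatorname{supp}y$, where $\operatorname{supp}$ is taken with respect to $(e_i)$. The basis $(e_i)$ satisfies $(p,q)$-estimates, where $1<q\le p<\infty$, if there exists $C>0$ such that $\frac1C(\sum_{k=1}^n\|x_k\|^p)^{1/p}\le\|\sum_{k=1}^nx_k\|\le C(\sum_{k=1}^n\|x_k\|^q)^{1/q}$ whenever $x_1<x_2<\dots<x_n$. *)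

theory Defs
  imports "HOL-Analysis.Analysis"
begin

text \<open>
  Banach spaces over the scalar field \<open>'k\<close>. The sort
  \<open>{real_normed_field, banach}\<close> has both \<open>real\<close> and \<open>complex\<close> as instances, and by the
  Gelfand--Mazur theorem these are its only instances up to isometric isomorphism. The norm and
  the additive structure of the space come from its type; the library has no class of complex
  Banach spaces, so the scalar multiplication is an explicit parameter extending the real one.
\<close>

locale banach_space_over = vector_space smul
  for smul :: "'k::{real_normed_field,banach} \<Rightarrow> 'a::banach \<Rightarrow> 'a" +
  assumes scale_of_real: "smul (of_real r) x = r *\<^sub>R x"
    and norm_scale: "norm (smul c x) = norm c * norm x"

lemma banach_space_over_real: "banach_space_over (scaleR :: real \<Rightarrow> 'a::banach \<Rightarrow> 'a)"
  by unfold_locales (auto simp: algebra_simps)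

lemma banach_space_over_complex: "banach_space_over ((*) :: complex \<Rightarrow> complex \<Rightarrow> complex)"
  by unfold_locales (auto simp: algebra_simps scaleR_conv_of_real norm_mult)

definition closed_infdim_subspace ::
    "('k::{real_normed_field,banach} \<Rightarrow> 'a::banach \<Rightarrow> 'a) \<Rightarrow> 'a set \<Rightarrow> bool" where
  "closed_infdim_subspace smul Y \<longleftrightarrow>
     module.subspace smul Y \<and> closed Y \<and> \<not> (\<exists>B. finite B \<and> module.span smul B = Y)"


subsection \<open>Almost transitive norms\<close>

text \<open>Norms on \<open>Y\<close> and operators on \<open>Y\<close> are total functions; only their values on \<open>Y\<close> matter.\<close>

definition norm_on ::
    "('k::{real_normed_field,banach} \<Rightarrow> 'a::banach \<Rightarrow> 'a) \<Rightarrow> 'a set \<Rightarrow> ('a \<Rightarrow> real) \<Rightarrow> bool" where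
  "norm_on smul Y N \<longleftrightarrow>
     (\<forall>x\<in>Y. 0 \<le> N x) \<and>
     (\<forall>x\<in>Y. N x = 0 \<longleftrightarrow> x = 0) \<and>
     (\<forall>c. \<forall>x\<in>Y. N (smul c x) = norm c * N x) \<and>
     (\<forall>x\<in>Y. \<forall>y\<in>Y. N (x + y) \<le> N x + N y)"

definition equivalent_norm_on ::
    "('k::{real_normed_field,banach} \<Rightarrow> 'a::banach \<Rightarrow> 'a) \<Rightarrow> 'a set \<Rightarrow> ('a \<Rightarrow> real) \<Rightarrow> bool" where
  "equivalent_norm_on smul Y N \<longleftrightarrow>
     norm_on smul Y N \<and> (\<exists>a>0. \<exists>b>0. \<forall>y\<in>Y. a * norm y \<le> N y \<and> N y \<le> b * norm y)"

definition surj_linear_isometries ::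
    "('k::{real_normed_field,banach} \<Rightarrow> 'a::banach \<Rightarrow> 'a) \<Rightarrow> 'a set \<Rightarrow> ('a \<Rightarrow> real) \<Rightarrow> ('a \<Rightarrow> 'a) set" where
  "surj_linear_isometries smul Y N =
     {T. T ` Y = Y \<and>
         (\<forall>x\<in>Y. \<forall>y\<in>Y. T (x + y) = T x + T y) \<and>
         (\<forall>c. \<forall>x\<in>Y. T (smul c x) = smul c (T x)) \<and>
         (\<forall>x\<in>Y. N (T x) = N x)}"

definition almost_transitive ::
    "('k::{real_normed_field,banach} \<Rightarrow> 'a::banach \<Rightarrow> 'a) \<Rightarrow> 'a set \<Rightarrow> ('a \<Rightarrow> real) \<Rightarrow> bool" where
  "almost_transitive smul Y N \<longleftrightarrow>
     (\<forall>y\<in>Y. N y = 1 \<longrightarrow> (\<forall>z\<in>Y. N z = 1 \<longrightarrow>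
        (\<forall>\<epsilon>>0. \<exists>T\<in>surj_linear_isometries smul Y N. N (T y - z) < \<epsilon>)))"


subsection \<open>Schauder bases and \<open>(p,q)\<close>-estimates\<close>

definition schauder_basis ::
    "('k::{real_normed_field,banach} \<Rightarrow> 'a::banach \<Rightarrow> 'a) \<Rightarrow> (nat \<Rightarrow> 'a) \<Rightarrow> bool" where
  "schauder_basis smul e \<longleftrightarrow> (\<forall>x. \<exists>!a. (\<lambda>i. smul (a i) (e i)) sums x)"

definition coeffs ::
    "('k::{real_normed_field,banach} \<Rightarrow> 'a::banach \<Rightarrow> 'a) \<Rightarrow> (nat \<Rightarrow> 'a) \<Rightarrow> 'a \<Rightarrow> nat \<Rightarrow> 'k" where
  "coeffs smul e x = (THE a. (\<lambda>i. smul (a i) (e i)) sums x)"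

definition supp ::
    "('k::{real_normed_field,banach} \<Rightarrow> 'a::banach \<Rightarrow> 'a) \<Rightarrow> (nat \<Rightarrow> 'a) \<Rightarrow> 'a \<Rightarrow> nat set" where
  "supp smul e x = {i. coeffs smul e x i \<noteq> 0}"

text \<open>
  The relation \<open>max supp x < min supp y\<close> only makes sense when the maximum and the minimum exist,
  so both vectors are nonzero and \<open>x\<close> has finite support. The support of \<open>y\<close> may be infinite,
  hence the least element is written \<open>Inf\<close> rather than \<open>Min\<close>. Allowing a zero vector inside a
  chain would make consecutive comparisons insufficient to force disjoint supports.
\<close>

definition block_less ::
    "('k::{real_normed_field,banach} \<Rightarrow> 'a::banach \<Rightarrow> 'a) \<Rightarrow> (nat \<Rightarrow> 'a) \<Rightarrow> 'a \<Rightarrow> 'a \<Rightarrow> bool" where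
  "block_less smul e x y \<longleftrightarrow>
     supp smul e x \<noteq> {} \<and> finite (supp smul e x) \<and> supp smul e y \<noteq> {} \<and>
     Max (supp smul e x) < Inf (supp smul e y)"

definition pq_estimates ::
    "('k::{real_normed_field,banach} \<Rightarrow> 'a::banach \<Rightarrow> 'a) \<Rightarrow> (nat \<Rightarrow> 'a) \<Rightarrow> real \<Rightarrow> real \<Rightarrow> bool" where
  "pq_estimates smul e p q \<longleftrightarrow>
     (\<exists>C>0. \<forall>n. \<forall>x :: nat \<Rightarrow> 'a.
        (\<forall>k\<in>{1..<n}. block_less smul e (x k) (x (Suc k))) \<longrightarrow>
        1 / C * (\<Sum>k=1..n. norm (x k) powr p) powr (1 / p) \<le> norm (\<Sum>k=1..n. x k) \<and>
        norm (\<Sum>k=1..n. x k) \<le> C * (\<Sum>k=1..n. norm (x k) powr q) powr (1 / q))"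

end

theory Submission
  imports Defs "Jordan_Normal_Form.Determinant" "HOL-Computational_Algebra.Fundamental_Theorem_Algebra"
begin

text \<open>
  Let \<open>\<E>\<close> be an ellipsoid of almost extremal volume circumscribed about, or inscribed in, the unit
  ball of a \<open>2k\<close>-dimensional subspace of \<open>Y\<close>. Near a point \<open>x\<close> where \<open>\<E>\<close> almost touches the ball,
  the Euclidean norm of \<open>\<E>\<close> bounds \<open>N (x + t y)\<^sup>2\<close> from below by about \<open>1 + c t\<^sup>2\<close>, respectively from
  above by about \<open>1 + C t\<^sup>2\<close>, for \<open>y\<close> orthogonal to \<open>x\<close>; and, by the argument of Dvoretzky and
  Rogers, the ball contains \<open>k\<close> vectors, for \<open>k\<close> as large as we please, that are uniformly separated,
  respectively have norms bounded below while any \<open>s\<close> of them have a sum of norm at most \<open>sqrt s\<close>.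
  Almost transitivity moves \<open>x\<close> to any prescribed point of the sphere. If \<open>k\<close> is large, two of the moved
  vectors have almost the same first \<open>m\<close> coordinates, so their difference \<open>y\<close> is nearly supported
  beyond \<open>m\<close>. Iterating produces nearly block sequences whose sums of length \<open>n\<close> have norm at least
  of order \<open>n\<close> to the power \<open>1/2\<close>, and others whose sums have norm at most of that order; the first
  contradict the upper estimate if \<open>q > 2\<close>, the second contradict the lower estimate if \<open>p < 2\<close>.
\<close>

subsection \<open>Determinants of orthogonal contractions\<close>

text \<open>Two obstacles shape the argument. Orthogonality to \<open>x\<close> refers to the
  Euclidean structure of the ellipsoid, and the isometry that moves \<open>x\<close> has no relation
  to the basis. One pigeonhole meets both: each moved vector is recorded together with its Euclidean
  inner product \<open>g i\<close> against \<open>x\<close>, so the difference of two vectors with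
  nearly equal records is at once almost orthogonal to \<open>x\<close> and almost supported far
  out. The number of vectors required depends only on the tolerance and on the compact set of
  possible records; it is therefore fixed before ellipsoid and isometry are chosen. The estimates at
  a unit vector are quadratic in \<open>t\<close>. Used at \<open>v / N v\<close> with
  \<open>t = 1 / N v\<close>, they become additive estimates for \<open>(N v)^2\<close> whose
  constants do not depend on \<open>N v\<close>; this is where the exponent 1/2 comes from. The
  ellipsoids are real even over complex scalars. Since the scalars form an arbitrary complete real
  normed field, compactness of bounded sets of coordinates is itself derived, from a weak
  Gelfand-Mazur theorem.\<close>

definition ndet :: "nat \<Rightarrow> (nat \<Rightarrow> nat \<Rightarrow> real) \<Rightarrow> real" where
  "ndet n a = Determinant.det (mat n n (\<lambda>(i,j). a i j))"

lemma ndet_mult: "ndet n (\<lambda>i j. \<Sum>k<n. a i k * b k j) = ndet n a * ndet n b"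
proof -
  have "mat n n (\<lambda>(i,j). \<Sum>k<n. a i k * b k j) = mat n n (\<lambda>(i,j). a i j) * mat n n (\<lambda>(i,j). b i j)"
    by (rule eq_matI) (auto simp: scalar_prod_def lessThan_atLeast0)
  then show ?thesis
    unfolding ndet_def by (simp add: Determinant.det_mult[of _ n])
qed

lemma ndet_scale: "ndet n (\<lambda>i j. c * a i j) = c ^ n * ndet n a"
proof -
  have "mat n n (\<lambda>(i,j). c * a i j) = c \<cdot>\<^sub>m mat n n (\<lambda>(i,j). a i j)"
    by (rule eq_matI) auto
  then show ?thesis unfolding ndet_def by simp
qed

lemma ndet_id: "ndet n (\<lambda>i j. if i = j then 1 else 0) = 1"
proof -
  have "mat n n (\<lambda>(i,j). if i = j then 1 else 0) = (1\<^sub>m n :: real mat)"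
    by (rule eq_matI) auto
  then show ?thesis unfolding ndet_def by simp
qed

text \<open>The Leibniz formula has n! terms, each at most \<open>K ^ n\<close> in absolute value.
  This makes the set of determinants of admissible maps bounded, so that its supremum
  exists.\<close>

lemma ndet_bound:
  assumes "\<And>i j. i < n \<Longrightarrow> j < n \<Longrightarrow> \<bar>a i j\<bar> \<le> K"
  shows "\<bar>ndet n a\<bar> \<le> fact n * K ^ n"
proof -
  let ?A = "mat n n (\<lambda>(i,j). a i j)" and ?P = "{p. p permutes {0..<n}}"
  have "\<bar>ndet n a\<bar> = \<bar>\<Sum>p\<in>?P. signof p * (\<Prod>i = 0..<n. ?A $$ (i, p i))\<bar>"
    unfolding ndet_def by (subst det_def'[of _ n]) auto
  also have "\<dots> \<le> (\<Sum>p\<in>?P. \<bar>signof p * (\<Prod>i = 0..<n. ?A $$ (i, p i))\<bar>)"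
    by (rule sum_abs)
  also have "\<dots> \<le> (\<Sum>p\<in>?P. K ^ n)"
  proof (rule sum_mono)
    fix p assume p: "p \<in> ?P"
    have "\<bar>\<Prod>i = 0..<n. ?A $$ (i, p i)\<bar> \<le> (\<Prod>i = 0..<n. K)"
      unfolding abs_prod using p assms
      by (intro prod_mono) (auto simp: permutes_in_image)
    then show "\<bar>signof p * (\<Prod>i = 0..<n. ?A $$ (i, p i))\<bar> \<le> K ^ n"
      by (auto simp: abs_mult sign_def)
  qed
  also have "\<dots> = fact n * K ^ n"
    by (simp add: card_permutations)
  finally show ?thesis .
qed

text \<open>The matrix determinant lemma, in the form det (I + U V) = det (1 + V U) for a column
  \<open>U\<close> and a row \<open>V\<close>.\<close>

lemma ndet_rank_one:
  "ndet n (\<lambda>i j. (if i = j then 1 else 0) + u i * v j) = 1 + (\<Sum>i<n. u i * v i)"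
proof -
  define I where "I = (1\<^sub>m n :: real mat)"
  define U where "U = mat n 1 (\<lambda>(i,j). u i)"
  define V where "V = mat 1 n (\<lambda>(i,j). v j)"
  define Z where "Z = (0\<^sub>m n 1 :: real mat)"
  define Z' where "Z' = (0\<^sub>m 1 n :: real mat)"
  define J where "J = (1\<^sub>m 1 :: real mat)"
  note d = I_def U_def V_def Z_def Z'_def J_def
  have c: "I \<in> carrier_mat n n" "U \<in> carrier_mat n 1" "V \<in> carrier_mat 1 n"
     "Z \<in> carrier_mat n 1" "Z' \<in> carrier_mat 1 n" "J \<in> carrier_mat 1 1"
    by (auto simp: d)
  \<comment> \<open>\<open>?L\<close> is unipotent and satisfies \<open>?R * ?L = ?L * ?M\<close>,
    so the two block triangular matrices \<open>?M\<close> and \<open>?R\<close> have equal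
    determinants; these are the two sides of the claim.\<close>
  let ?L = "four_block_mat I Z V J" and ?M = "four_block_mat (I + U * V) U Z' J"
    and ?R = "four_block_mat I U Z' (J + V * U)"
  have UV: "U * V \<in> carrier_mat n n" "V * U \<in> carrier_mat 1 1" using c by auto
  have "?L * ?M = four_block_mat (I * (I + U * V) + Z * Z') (I * U + Z * J) (V * (I + U * V) + J * Z') (V * U + J * J)"
    by (rule mult_four_block_mat[of _ n n _ 1 _ 1 _ _ n _ 1]) (use c UV in auto)
  have e1: "?R * ?L = four_block_mat (I * I + U * V) (I * Z + U * J) (Z' * I + (J + V * U) * V) (Z' * Z + (J + V * U) * J)"
    by (rule mult_four_block_mat[of _ n n _ 1 _ 1 _ _ n _ 1]) (use c UV in auto)
  have e2: "?L * ?M = four_block_mat (I * (I + U * V) + Z * Z') (I * U + Z * J) (V * (I + U * V) + J * Z') (V * U + J * J)"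
    by fact
  have "I * I + U * V = I * (I + U * V) + Z * Z'" "I * Z + U * J = I * U + Z * J"
    using c UV by (auto simp: d)
  moreover have "Z' * I + (J + V * U) * V = V * (I + U * V) + J * Z'"
  proof -
    have "(J + V * U) * V = J * V + V * U * V" using c UV by (intro add_mult_distrib_mat) auto
    moreover have "V * (I + U * V) = V * I + V * (U * V)" using c UV by (intro mult_add_distrib_mat) auto
    moreover have "V * U * V = V * (U * V)" using c by (intro assoc_mult_mat) auto
    ultimately show ?thesis using c UV by (auto simp: d)
  qed
  moreover have "Z' * Z + (J + V * U) * J = V * U + J * J"
    using c UV by (auto simp: d intro: comm_add_mat)
  ultimately have "?R * ?L = ?L * ?M" unfolding e1 e2 by simp
  then have "Determinant.det ?R * Determinant.det ?L = Determinant.det ?L * Determinant.det ?M"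
    using c UV by (metis Determinant.det_mult add_carrier_mat four_block_carrier_mat)
  moreover have "Determinant.det ?L = 1"
    by (subst det_four_block_mat_upper_right_zero[of _ n _ 1]) (use c in \<open>auto simp: d\<close>)
  moreover have "Determinant.det ?M = Determinant.det (I + U * V)"
    by (subst det_four_block_mat_lower_left_zero[of _ n _ 1]) (use c UV in \<open>auto simp: d\<close>)
  moreover have "Determinant.det ?R = Determinant.det (J + V * U)"
    by (subst det_four_block_mat_lower_left_zero[of _ n _ 1]) (use c UV in \<open>auto simp: d\<close>)
  ultimately have "Determinant.det (I + U * V) = Determinant.det (J + V * U)" by simp
  moreover have "Determinant.det (J + V * U) = 1 + (\<Sum>i<n. u i * v i)"
    using c UV by (subst det_single) (auto simp: d scalar_prod_def lessThan_atLeast0 mult.commute intro!: sum.cong)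
  moreover have "I + U * V = mat n n (\<lambda>(i,j). (if i = j then 1 else 0) + u i * v j)"
    by (rule eq_matI) (auto simp: d scalar_prod_def)
  ultimately show ?thesis unfolding ndet_def by simp
qed

lemma ndet_cong: "(\<And>i j. i < n \<Longrightarrow> j < n \<Longrightarrow> a i j = b i j) \<Longrightarrow> ndet n a = ndet n b"
  unfolding ndet_def by (rule arg_cong[where f = Determinant.det]) (auto intro: eq_matI)

section \<open>Euclidean inner product, orthonormal systems and projections in coordinates\<close>

definition iprod :: "nat \<Rightarrow> (nat \<Rightarrow> real) \<Rightarrow> (nat \<Rightarrow> real) \<Rightarrow> real" where
  "iprod n x y = (\<Sum>i<n. x i * y i)"

definition mat_app :: "nat \<Rightarrow> (nat \<Rightarrow> nat \<Rightarrow> real) \<Rightarrow> (nat \<Rightarrow> real) \<Rightarrow> nat \<Rightarrow> real" where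
  "mat_app n a x = (\<lambda>i. \<Sum>j<n. a i j * x j)"

lemma iprod_commute: "iprod n x y = iprod n y x"
  by (simp add: iprod_def mult.commute)

lemma iprod_cong: "(\<And>i. i < n \<Longrightarrow> x i = x' i) \<Longrightarrow> (\<And>i. i < n \<Longrightarrow> y i = y' i) \<Longrightarrow> iprod n x y = iprod n x' y'"
  by (simp add: iprod_def)

lemma iprod_linear:
  "iprod n (\<lambda>i. x i + y i) z = iprod n x z + iprod n y z"
  "iprod n (\<lambda>i. x i - y i) z = iprod n x z - iprod n y z"
  "iprod n (\<lambda>i. c * x i) z = c * iprod n x z"
  "iprod n z (\<lambda>i. x i + y i) = iprod n z x + iprod n z y"
  "iprod n z (\<lambda>i. x i - y i) = iprod n z x - iprod n z y"
  "iprod n z (\<lambda>i. c * x i) = c * iprod n z x"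
  by (simp_all add: iprod_def algebra_simps sum.distrib sum_subtractf sum_distrib_left)

lemma iprod_sum_right: "iprod n z (\<lambda>i. \<Sum>j\<in>J. f j i) = (\<Sum>j\<in>J. iprod n z (f j))"
  by (simp add: iprod_def sum_distrib_left) (rule sum.swap)

lemma iprod_nonneg [simp]: "0 \<le> iprod n x x"
  by (simp add: iprod_def sum_nonneg)

lemma iprod_Cauchy_Schwarz: "(iprod n x y)\<^sup>2 \<le> iprod n x x * iprod n y y"
  using Cauchy_Schwarz_ineq_sum[of x y "{..<n}"] by (simp add: iprod_def power2_eq_square)

lemma iprod_abs_le: "iprod n x x \<le> 1 \<Longrightarrow> iprod n y y \<le> 1 \<Longrightarrow> \<bar>iprod n x y\<bar> \<le> 1"
proof -
  assume "iprod n x x \<le> 1" "iprod n y y \<le> 1"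
  then have "iprod n x x * iprod n y y \<le> 1 * 1" by (intro mult_mono) auto
  then have "(iprod n x y)\<^sup>2 \<le> 1" using iprod_Cauchy_Schwarz[of n x y] by simp
  then show ?thesis by (simp add: abs_square_le_1)
qed

lemma iprod_ge_component: "i < n \<Longrightarrow> (x i)\<^sup>2 \<le> iprod n x x"
  unfolding iprod_def power2_eq_square by (rule member_le_sum) auto

lemma mat_app_linear:
  "mat_app n a (\<lambda>i. x i + y i) = (\<lambda>i. mat_app n a x i + mat_app n a y i)"
  "mat_app n a (\<lambda>i. x i - y i) = (\<lambda>i. mat_app n a x i - mat_app n a y i)"
  "mat_app n a (\<lambda>i. c * x i) = (\<lambda>i. c * mat_app n a x i)"
  by (simp_all add: mat_app_def algebra_simps sum.distrib sum_subtractf sum_distrib_left)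

lemma mat_app_sum: "mat_app n a (\<lambda>i. \<Sum>j\<in>J. f j i) = (\<lambda>i. \<Sum>j\<in>J. mat_app n a (f j) i)"
  by (rule ext) (simp add: mat_app_def sum_distrib_left, rule sum.swap)

lemma mat_app_cong: "(\<And>i. i < n \<Longrightarrow> x i = y i) \<Longrightarrow> mat_app n a x = mat_app n a y"
  by (simp add: mat_app_def)

lemma mat_app_mult: "mat_app n (\<lambda>i j. \<Sum>k<n. a i k * b k j) x = mat_app n a (mat_app n b x)"
  by (rule ext) (simp add: mat_app_def sum_distrib_left sum_distrib_right mult.assoc, rule sum.swap)

lemma mat_app_unit: "j < n \<Longrightarrow> mat_app n a (\<lambda>i. if i = j then 1 else 0) i = a i j"
  by (simp add: mat_app_def if_distrib cong: if_cong)

lemma iprod_unit: "j < n \<Longrightarrow> iprod n (\<lambda>i. if i = j then 1 else 0) (\<lambda>i. if i = j then 1 else 0) = 1"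
  by (simp add: iprod_def if_distrib[of "\<lambda>z. z * _"] cong: if_cong)

definition orthonormal :: "nat \<Rightarrow> nat \<Rightarrow> (nat \<Rightarrow> nat \<Rightarrow> real) \<Rightarrow> bool" where
  "orthonormal n r u \<longleftrightarrow> (\<forall>j<r. \<forall>l<r. iprod n (u j) (u l) = (if j = l then 1 else 0))"

definition proj :: "nat \<Rightarrow> nat \<Rightarrow> (nat \<Rightarrow> nat \<Rightarrow> real) \<Rightarrow> (nat \<Rightarrow> real) \<Rightarrow> nat \<Rightarrow> real" where
  "proj n r u x = (\<lambda>i. \<Sum>j<r. iprod n (u j) x * u j i)"

lemma iprod_proj: "iprod n z (proj n r u x) = (\<Sum>j<r. iprod n (u j) x * iprod n z (u j))"
  unfolding proj_def by (simp add: iprod_sum_right iprod_linear)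

lemma iprod_proj_basis:
  assumes "orthonormal n r u" "l < r"
  shows "iprod n (u l) (proj n r u x) = iprod n (u l) x"
proof -
  have "(\<Sum>j<r. iprod n (u j) x * iprod n (u l) (u j)) = (\<Sum>j<r. if j = l then iprod n (u l) x else 0)"
    using assms by (intro sum.cong) (auto simp: orthonormal_def)
  then show ?thesis using assms by (simp add: iprod_proj)
qed

lemma iprod_proj_proj:
  assumes "orthonormal n r u"
  shows "iprod n (proj n r u x) (proj n r u x) = iprod n x (proj n r u x)"
proof -
  have "iprod n (proj n r u x) (proj n r u x) = (\<Sum>j<r. iprod n (u j) x * iprod n (u j) (proj n r u x))"
    by (subst iprod_proj) (simp add: iprod_commute)
  also have "\<dots> = (\<Sum>j<r. iprod n (u j) x * iprod n (u j) x)"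
    using assms by (intro sum.cong) (auto simp: iprod_proj_basis)
  finally show ?thesis by (simp add: iprod_proj iprod_commute)
qed

lemma proj_Pythagoras:
  fixes x :: "nat \<Rightarrow> real"
  assumes "orthonormal n r u"
  defines "y \<equiv> \<lambda>i. x i - proj n r u x i"
  shows "iprod n x x = iprod n y y + iprod n (proj n r u x) (proj n r u x)"
    and "iprod n y (proj n r u x) = 0"
    and "l < r \<Longrightarrow> iprod n y (u l) = 0"
    using iprod_proj_basis[OF assms(1), of l x]
  by (simp_all add: y_def iprod_linear iprod_proj_proj[OF assms(1)] iprod_commute)

text \<open>For orthonormal \<open>u\<close> this is the matrix of I - (3/4) Q, where Q is the
  orthogonal projection onto the span of the first \<open>r\<close> vectors: it is 1/4 on that span
  and the identity on its complement.\<close>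

definition contraction :: "nat \<Rightarrow> (nat \<Rightarrow> nat \<Rightarrow> real) \<Rightarrow> nat \<Rightarrow> nat \<Rightarrow> real" where
  "contraction r u i k = (if i = k then 1 else 0) - 3/4 * (\<Sum>j<r. u j i * u j k)"

lemma mat_app_contraction:
  assumes "i < n"
  shows "mat_app n (contraction r u) x i = x i - 3/4 * proj n r u x i"
proof -
  have "mat_app n (contraction r u) x i = (\<Sum>k<n. if k = i then x i else 0) - 3/4 * (\<Sum>k<n. \<Sum>j<r. u j i * u j k * x k)"
    unfolding mat_app_def contraction_def sum_distrib_left sum_subtractf[symmetric]
    by (intro sum.cong) (auto simp: left_diff_distrib sum_distrib_right sum_distrib_left mult.assoc)
  also have "(\<Sum>k<n. \<Sum>j<r. u j i * u j k * x k) = proj n r u x i"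
    unfolding proj_def iprod_def sum_distrib_right by (subst sum.swap) (simp add: mult_ac)
  finally show ?thesis using assms by simp
qed

text \<open>Each new vector contributes a factor I - (3/4) v v^T of determinant 1 - 3/4. Since the
  earlier contraction fixes the new vector, multiplying by this factor on the right yields exactly
  the next contraction.\<close>

lemma ndet_contraction:
  assumes "orthonormal n r u"
  shows "ndet n (contraction r u) = (1/4) ^ r"
  using assms
proof (induction r)
  case 0
  then show ?case by (simp add: contraction_def ndet_id)
next
  case (Suc r)
  have on: "orthonormal n r u" and ur: "iprod n (u r) (u r) = 1" "\<And>j. j < r \<Longrightarrow> iprod n (u j) (u r) = 0"
    using Suc.prems by (auto simp: orthonormal_def)
  let ?b = "\<lambda>i j. (if i = j then 1 else 0) + (- 3/4 * u r i) * u r j"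
  have "ndet n (contraction (Suc r) u) = ndet n (\<lambda>i j. \<Sum>k<n. contraction r u i k * ?b k j)"
  proof (rule ndet_cong)
    fix i j assume ij: "i < n" "j < n"
    have "(\<Sum>k<n. contraction r u i k * ?b k j) = (\<Sum>k<n. if k = j then contraction r u i j else 0) - 3/4 * u r j * mat_app n (contraction r u) (u r) i"
      unfolding mat_app_def sum_distrib_left sum_subtractf[symmetric]
      by (intro sum.cong) (auto simp: algebra_simps)
    also have "\<dots> = contraction r u i j - 3/4 * u r j * u r i"
      using ij ur by (simp add: mat_app_contraction proj_def)
    also have "\<dots> = contraction (Suc r) u i j" by (simp add: contraction_def algebra_simps)
    finally show "contraction (Suc r) u i j = (\<Sum>k<n. contraction r u i k * ?b k j)" ..
  qed
  also have "\<dots> = (1/4) ^ r * ndet n ?b" by (simp only: ndet_mult Suc.IH[OF on])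
  also have "ndet n ?b = 1 + (\<Sum>i<n. (- 3/4 * u r i) * u r i)" by (rule ndet_rank_one)
  also have "(\<Sum>i<n. (- 3/4 * u r i) * u r i) = - 3/4 * iprod n (u r) (u r)"
    by (simp add: iprod_def sum_distrib_left sum_negf mult.assoc)
  finally show ?case using ur by simp
qed

subsection \<open>Ellipsoids of almost extremal volume\<close>

text \<open>Any element above \<open>Sup S / \<tau>\<close> will do. Such near-maximisers play the
  part of John's extremal ellipsoid; the loss \<open>\<tau>\<close> is later taken no larger than
  the gain of each deformation that is to be excluded.\<close>

lemma near_supremum:
  fixes S :: "real set"
  assumes "bdd_above S" "s0 \<in> S" "0 < s0" "1 < \<tau>"
  obtains s where "s \<in> S" "0 < s" "\<And>s'. s' \<in> S \<Longrightarrow> s' < \<tau> * s"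
proof -
  have S: "0 < Sup S" using cSup_upper[OF assms(2,1)] assms(3) by linarith
  then have "Sup S / \<tau> < Sup S" using assms(4) by (simp add: field_simps)
  then obtain s where s: "s \<in> S" "Sup S / \<tau> < s"
    using less_cSup_iff[OF _ assms(1), of "Sup S / \<tau>"] assms(2) by blast
  have "0 < Sup S / \<tau>" using S assms(4) by simp
  with s have "0 < s" by linarith
  moreover have "s' < \<tau> * s" if "s' \<in> S" for s'
    using cSup_upper[OF that assms(1)] s assms(4) by (simp add: field_simps)
  ultimately show ?thesis using that s(1) by blast
qed

text \<open>A norm on real n-space, with vectors encoded as functions whose values beyond
  \<open>n\<close> are ignored. The constants \<open>\<kappa>\<close> and \<open>U\<close> compare
  it with the maximum norm and the sum norm; they give bounded determinants and an initial
  admissible map.\<close>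

locale fin_dim_norm =
  fixes n k :: nat and M :: "(nat \<Rightarrow> real) \<Rightarrow> real" and \<kappa> U :: real
  assumes n_eq: "n = 2 * k" and k_pos: "0 < k"
    and M_add: "M (\<lambda>i. x i + y i) \<le> M x + M y"
    and M_scale: "M (\<lambda>i. c * x i) = \<bar>c\<bar> * M x"
    and M_cong: "(\<And>i. i < n \<Longrightarrow> x i = y i) \<Longrightarrow> M x = M y"
    and \<kappa>_pos: "0 < \<kappa>" and M_lower: "i < n \<Longrightarrow> \<kappa> * \<bar>x i\<bar> \<le> M x"
    and U_pos: "0 < U" and M_upper: "M x \<le> U * (\<Sum>i<n. \<bar>x i\<bar>)"
begin

lemma n_pos: "0 < n" using n_eq k_pos by simp

lemma M_nonneg [simp]: "0 \<le> M x"
  using M_lower[of 0 x] n_pos \<kappa>_pos by (meson abs_ge_zero mult_nonneg_nonneg order_less_imp_le order_trans)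

lemma iprod_le_M: "iprod n x x \<le> n * (M x / \<kappa>)\<^sup>2"
proof -
  have "iprod n x x \<le> (\<Sum>i<n. (M x / \<kappa>)\<^sup>2)"
    unfolding iprod_def
  proof (rule sum_mono)
    fix i assume "i \<in> {..<n}"
    then have "\<bar>x i\<bar> \<le> M x / \<kappa>" using M_lower[of i x] \<kappa>_pos by (simp add: field_simps)
    then show "x i * x i \<le> (M x / \<kappa>)\<^sup>2"
      using power_mono[of "\<bar>x i\<bar>" "M x / \<kappa>" 2] by (simp add: power2_eq_square)
  qed
  then show ?thesis by simp
qed

lemma M_le_ip: "(M x)\<^sup>2 \<le> (U * n)\<^sup>2 * iprod n x x"
proof -
  have "\<bar>x i\<bar> \<le> sqrt (iprod n x x)" if "i < n" for i
    using iprod_ge_component[OF that, of x] real_le_rsqrt[of "\<bar>x i\<bar>" "iprod n x x"] by simp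
  then have "(\<Sum>i<n. \<bar>x i\<bar>) \<le> (\<Sum>i<n. sqrt (iprod n x x))" by (intro sum_mono) auto
  then have "M x \<le> U * (n * sqrt (iprod n x x))"
    using order_trans[OF M_upper[of x] mult_left_mono] U_pos by simp
  then have "(M x)\<^sup>2 \<le> (U * (n * sqrt (iprod n x x)))\<^sup>2" by (intro power_mono) auto
  then show ?thesis by (simp add: power_mult_distrib algebra_simps)
qed

text \<open>The ellipsoid of all \<open>x\<close> with |a x| \<le> 1 contains the unit ball of
  \<open>M\<close>. Its volume is inversely proportional to the determinant, so small ellipsoids
  correspond to large \<open>ndet n a\<close>.\<close>

definition circumscribed :: "(nat \<Rightarrow> nat \<Rightarrow> real) \<Rightarrow> bool" where
  "circumscribed a \<longleftrightarrow> (\<forall>x. iprod n (mat_app n a x) (mat_app n a x) \<le> (M x)\<^sup>2)"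

text \<open>Here the ellipsoid is the image of the Euclidean unit ball under \<open>a\<close>, and
  it lies inside the unit ball of \<open>M\<close>; its volume grows with the determinant, so both
  extremal problems become maximisations of \<open>ndet\<close>.\<close>

definition inscribed :: "(nat \<Rightarrow> nat \<Rightarrow> real) \<Rightarrow> bool" where
  "inscribed a \<longleftrightarrow> (\<forall>x. (M (mat_app n a x))\<^sup>2 \<le> iprod n x x)"

lemma mat_app_diag: "i < n \<Longrightarrow> mat_app n (\<lambda>i j. c * (if i = j then 1 else 0)) x i = c * x i"
  by (simp add: mat_app_def mult.assoc if_distrib[of "\<lambda>z. z * _"] if_distrib[of "\<lambda>z. _ * z"] cong: if_cong)

lemma ndet_diag: "ndet n (\<lambda>i j. c * (if i = j then 1 else 0)) = c ^ n"
  by (simp only: ndet_scale ndet_id mult_1_right)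

lemma near_extremal_circumscribed:
  assumes "1 < \<tau>"
  obtains a where "circumscribed a" "0 < ndet n a" "\<And>a'. circumscribed a' \<Longrightarrow> ndet n a' < \<tau> * ndet n a"
proof -
  let ?S = "{ndet n a | a. circumscribed a}"
  have "\<bar>a i j\<bar> \<le> U" if "circumscribed a" "i < n" "j < n" for a i j
  proof -
    let ?e = "\<lambda>i. if i = j then 1 else 0 :: real"
    have "(a i j)\<^sup>2 \<le> iprod n (mat_app n a ?e) (mat_app n a ?e)"
      using iprod_ge_component[OF that(2), of "mat_app n a ?e"] by (simp add: mat_app_unit[OF that(3)])
    also have "\<dots> \<le> (M ?e)\<^sup>2" using that(1) by (simp add: circumscribed_def)
    also have "\<dots> \<le> U\<^sup>2"
      using M_upper[of ?e] that(3) by (intro power_mono) (auto simp: if_distrib[of abs] cong: if_cong)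
    finally show ?thesis using U_pos by (simp add: abs_le_square_iff[symmetric])
  qed
  then have "bdd_above ?S"
    using ndet_bound[of n _ U] by (intro bdd_aboveI[of _ "fact n * U ^ n"]) (auto intro: order_trans[OF abs_ge_self])
  \<comment> \<open>A small multiple of the identity is admissible because |x|^2 \<le> n (M x /
    \<kappa>)^2; it witnesses that the supremum is positive.\<close>
  moreover have feas: "circumscribed (\<lambda>i j. (\<kappa> / n) * (if i = j then 1 else 0))"
    unfolding circumscribed_def
  proof
    fix x :: "nat \<Rightarrow> real"
    let ?y = "mat_app n (\<lambda>i j. (\<kappa> / n) * (if i = j then 1 else 0)) x"
    have "iprod n ?y ?y = (\<kappa> / n)\<^sup>2 * iprod n x x"
    proof -
      have "iprod n ?y ?y = iprod n (\<lambda>i. (\<kappa> / n) * x i) (\<lambda>i. (\<kappa> / n) * x i)"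
        by (rule iprod_cong) (rule mat_app_diag, assumption)+
      then show ?thesis by (simp only: iprod_linear power2_eq_square mult.assoc)
    qed
    also have "\<dots> \<le> (\<kappa> / n)\<^sup>2 * (n * (M x / \<kappa>)\<^sup>2)" by (intro mult_left_mono iprod_le_M) auto
    also have "\<dots> = (M x)\<^sup>2 / n" using \<kappa>_pos n_pos by (simp add: power2_eq_square field_simps)
    also have "\<dots> \<le> (M x)\<^sup>2" using n_pos mult_left_mono[of 1 "real n" "(M x)\<^sup>2"] by (simp add: divide_le_eq)
    finally show "iprod n ?y ?y \<le> (M x)\<^sup>2" .
  qed
  moreover have "(\<kappa> / n) ^ n \<in> ?S" unfolding mem_Collect_eq by (intro exI) (rule conjI[OF ndet_diag[symmetric] feas])
  moreover have "0 < (\<kappa> / n) ^ n" using \<kappa>_pos n_pos by simp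
  ultimately obtain s where "s \<in> ?S" "0 < s" "\<And>s'. s' \<in> ?S \<Longrightarrow> s' < \<tau> * s"
    using near_supremum[of ?S "(\<kappa> / n) ^ n" \<tau>] assms by blast
  then show ?thesis using that by blast
qed

lemma near_extremal_inscribed:
  assumes "1 < \<tau>"
  obtains a where "inscribed a" "0 < ndet n a" "\<And>a'. inscribed a' \<Longrightarrow> ndet n a' < \<tau> * ndet n a"
proof -
  let ?S = "{ndet n a | a. inscribed a}"
  have "\<bar>a i j\<bar> \<le> 1 / \<kappa>" if "inscribed a" "i < n" "j < n" for a i j
  proof -
    let ?e = "\<lambda>i. if i = j then 1 else 0 :: real"
    have "\<kappa> * \<bar>a i j\<bar> \<le> M (mat_app n a ?e)"
      using M_lower[OF that(2), of "mat_app n a ?e"] by (simp add: mat_app_unit[OF that(3)])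
    also have "(M (mat_app n a ?e))\<^sup>2 \<le> 1" using that(1) iprod_unit[OF that(3)] unfolding inscribed_def by metis
    then have "M (mat_app n a ?e) \<le> 1" using power2_le_imp_le[of _ 1] by simp
    finally show ?thesis using \<kappa>_pos by (simp add: field_simps)
  qed
  then have "bdd_above ?S"
    using ndet_bound[of n _ "1 / \<kappa>"]
    by (intro bdd_aboveI[of _ "fact n * (1 / \<kappa>) ^ n"]) (auto intro: order_trans[OF abs_ge_self])
  moreover have feas: "inscribed (\<lambda>i j. (1 / (U * n)) * (if i = j then 1 else 0))"
    unfolding inscribed_def
  proof
    fix x :: "nat \<Rightarrow> real"
    let ?c = "1 / (U * n)"
    let ?y = "mat_app n (\<lambda>i j. ?c * (if i = j then 1 else 0)) x"
    have "M ?y = \<bar>?c\<bar> * M x"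
      unfolding M_scale[symmetric] by (rule M_cong) (rule mat_app_diag)
    then have "(M ?y)\<^sup>2 = ?c\<^sup>2 * (M x)\<^sup>2" by (simp only: power_mult_distrib power2_abs)
    also have "\<dots> \<le> ?c\<^sup>2 * ((U * n)\<^sup>2 * iprod n x x)" by (intro mult_left_mono M_le_ip) auto
    also have "\<dots> = iprod n x x" using U_pos n_pos by (simp add: power2_eq_square)
    finally show "(M ?y)\<^sup>2 \<le> iprod n x x" .
  qed
  moreover have "(1 / (U * n)) ^ n \<in> ?S" unfolding mem_Collect_eq by (intro exI) (rule conjI[OF ndet_diag[symmetric] feas])
  moreover have "0 < (1 / (U * n)) ^ n" using U_pos n_pos by simp
  ultimately obtain s where "s \<in> ?S" "0 < s" "\<And>s'. s' \<in> ?S \<Longrightarrow> s' < \<tau> * s"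
    using near_supremum[of ?S "(1 / (U * n)) ^ n" \<tau>] assms by blast
  then show ?thesis using that by blast
qed

end

lemma mat_app_scale_mat: "mat_app n (\<lambda>i j. c * a i j) x = (\<lambda>i. c * mat_app n a x i)"
  by (simp add: mat_app_def sum_distrib_left mult.assoc)

lemma iprod_square_add:
  "iprod n (\<lambda>i. x i + c * y i) (\<lambda>i. x i + c * y i) = iprod n x x + 2 * c * iprod n x y + c\<^sup>2 * iprod n y y"
  unfolding iprod_linear(1)[of n x] iprod_linear(4)[of n _ x] iprod_linear(3,6)
  by (simp add: power2_eq_square algebra_simps iprod_commute[of n y x])

lemma iprod_extend_orthonormal:
  assumes "orthonormal n r u" "iprod n v v = 1" "\<And>j. j < r \<Longrightarrow> iprod n v (u j) = 0"
  shows "orthonormal n (Suc r) (u(r := v))"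
  using assms unfolding orthonormal_def by (auto simp: less_Suc_eq iprod_commute)

context fin_dim_norm
begin

text \<open>
  Stretching by \<open>sqrt 8\<close> off a subspace of dimension \<open>r < k\<close> and shrinking by \<open>sqrt 8 / 4\<close> on it at
  least doubles volumes in dimension \<open>n = 2 k\<close>, so an almost extremal map cannot stay admissible
  after such a deformation.
\<close>

lemma ndet_stretch:
  assumes "orthonormal n r u" "r < k"
  shows "2 \<le> ndet n (\<lambda>i j. sqrt 8 * contraction r u i j)"
proof -
  have "ndet n (\<lambda>i j. sqrt 8 * contraction r u i j) = 8 ^ k * (1/4) ^ r"
  proof -
    have "sqrt 8 ^ n = (8 :: real) ^ k" by (simp add: n_eq power_mult)
    then show ?thesis by (simp only: ndet_scale ndet_contraction[OF assms(1)])
  qed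
  moreover have "(8::real) ^ k * (1/4) ^ k \<le> 8 ^ k * (1/4) ^ r"
    using assms(2) by (intro mult_left_mono power_decreasing) auto
  moreover have "(8::real) ^ k * (1/4) ^ k = 2 ^ k" by (simp flip: power_mult_distrib)
  moreover have "(2::real) ^ 1 \<le> 2 ^ k" using k_pos by (intro power_increasing) auto
  ultimately show ?thesis by simp
qed

text \<open>With w = a x split into its projection Q w and the rest y, the deformed vector has
  square 8 |y|^2 + |Q w|^2 / 2. The threshold 1/16 bounds the first term by half of
  \<open>(M x)^2\<close>, and |w| \<le> M x bounds the second by the other half.\<close>

lemma circumscribed_stretch:
  assumes a: "circumscribed a" and u: "orthonormal n r u"
    and small: "\<And>z. iprod n (\<lambda>i. mat_app n a z i - proj n r u (mat_app n a z) i) (\<lambda>i. mat_app n a z i - proj n r u (mat_app n a z) i) \<le> (M z)\<^sup>2 / 16"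
  shows "circumscribed (\<lambda>i j. \<Sum>l<n. (sqrt 8 * contraction r u i l) * a l j)"
  unfolding circumscribed_def mat_app_mult
proof
  fix x
  let ?w = "mat_app n a x" and ?d = "\<lambda>i j. sqrt 8 * contraction r u i j"
  let ?P = "proj n r u ?w" and ?y = "\<lambda>i. mat_app n a x i - proj n r u (mat_app n a x) i"
  have arith: "8 * (y + (1/16) * p) \<le> 8 * (m / 16) + (1/2) * w" if "y \<le> m / 16" "w = y + p" "0 \<le> y"
    for y m w p :: real using that(1,3) unfolding that(2) by (simp add: add_divide_distrib)
  have s8: "sqrt 8 * (sqrt 8 * b) = 8 * b" for b by (simp flip: mult.assoc)
  have "iprod n (mat_app n ?d ?w) (mat_app n ?d ?w) = iprod n (\<lambda>i. sqrt 8 * (?y i + (1/4) * ?P i)) (\<lambda>i. sqrt 8 * (?y i + (1/4) * ?P i))"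
    by (rule iprod_cong) (simp_all add: mat_app_scale_mat mat_app_contraction)
  also have "\<dots> = 8 * (iprod n ?y ?y + (1/16) * iprod n ?P ?P)"
    using iprod_square_add[of n ?y "1/4" ?P] proj_Pythagoras(2)[OF u, of ?w]
    by (simp only: iprod_linear(3,6)[where c = "sqrt 8"] s8) (simp add: power2_eq_square)
  also have "\<dots> \<le> 8 * ((M x)\<^sup>2 / 16) + (1/2) * iprod n ?w ?w"
    using small[of x] proj_Pythagoras(1)[OF u, of ?w] by (rule arith) (rule iprod_nonneg)
  also have "\<dots> \<le> (M x)\<^sup>2" using a by (simp add: circumscribed_def field_simps)
  finally show "iprod n (mat_app n ?d ?w) (mat_app n ?d ?w) \<le> (M x)\<^sup>2" .
qed

text \<open>The ellipsoid is an image, so the deformation now acts on the source. From 8 (s + t/4)^2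
  \<le> 16 s^2 + t^2, the smallness assumption absorbs the factor 16 on the complement,
  admissibility handles the projection, and Pythagoras adds the two.\<close>

lemma inscribed_stretch:
  assumes a: "inscribed a" and u: "orthonormal n r u"
    and small: "\<And>w. (\<And>j. j < r \<Longrightarrow> iprod n w (u j) = 0) \<Longrightarrow> (M (mat_app n a w))\<^sup>2 \<le> iprod n w w / 16"
  shows "inscribed (\<lambda>i j. \<Sum>l<n. a i l * (sqrt 8 * contraction r u l j))"
  unfolding inscribed_def mat_app_mult
proof
  fix x
  let ?d = "\<lambda>i j. sqrt 8 * contraction r u i j"
  let ?P = "proj n r u x" and ?y = "\<lambda>i. x i - proj n r u x i"
  let ?s = "M (mat_app n a ?y)" and ?t = "M (mat_app n a ?P)"
  have "mat_app n a (mat_app n ?d x) = mat_app n a (\<lambda>i. sqrt 8 * (?y i + (1/4) * ?P i))"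
    by (rule mat_app_cong) (simp add: mat_app_scale_mat mat_app_contraction)
  also have "\<dots> = (\<lambda>i. sqrt 8 * (mat_app n a ?y i + (1/4) * mat_app n a ?P i))"
    by (simp only: mat_app_linear(1,3))
  finally have "M (mat_app n a (mat_app n ?d x)) = sqrt 8 * M (\<lambda>i. mat_app n a ?y i + (1/4) * mat_app n a ?P i)"
    by (simp add: M_scale)
  also have "\<dots> \<le> sqrt 8 * (?s + (1/4) * ?t)"
    using M_add[of "mat_app n a ?y" "\<lambda>i. (1/4) * mat_app n a ?P i"] M_scale[of "1/4" "mat_app n a ?P"]
    by (intro mult_left_mono) auto
  finally have "(M (mat_app n a (mat_app n ?d x)))\<^sup>2 \<le> (sqrt 8 * (?s + (1/4) * ?t))\<^sup>2"
    by (intro power_mono) auto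
  also have "\<dots> = 8 * (?s + (1/4) * ?t)\<^sup>2" by (simp add: power_mult_distrib)
  also have "\<dots> \<le> 16 * ?s\<^sup>2 + ?t\<^sup>2"
    using zero_le_power2[of "?s - (1/4) * ?t"] by (simp add: power2_eq_square algebra_simps)
  also have "\<dots> \<le> iprod n ?y ?y + iprod n ?P ?P"
    using small[of ?y] proj_Pythagoras(3)[OF u] a by (auto simp: inscribed_def intro!: add_mono)
  also have "\<dots> = iprod n x x" using proj_Pythagoras(1)[OF u, of x] by simp
  finally show "(M (mat_app n a (mat_app n ?d x)))\<^sup>2 \<le> iprod n x x" .
qed

section \<open>Dvoretzky-Rogers systems near the points of contact\<close>

lemma proj_scale: "proj n r u (\<lambda>i. c * x i) = (\<lambda>i. c * proj n r u x i)"
  by (simp add: proj_def iprod_linear sum_distrib_left mult.assoc)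

text \<open>The numbers \<open>g i\<close> stand for the inner products of the images of
  \<open>x\<close> and \<open>z i\<close>. The last estimate expands |a (x + t d)|^2 \<le> (M (x + t
  d))^2 with d = z i - z j: near contact at \<open>x\<close> gives 1 - \<eta>, and the Euclidean
  separation of the images gives 1/16.\<close>

lemma Dvoretzky_Rogers_circumscribed:
  assumes \<eta>: "0 < \<eta>" "\<eta> < 1"
  obtains x z g where "M x = 1" "\<And>i. i < k \<Longrightarrow> M (z i) = 1" "\<And>i. i < k \<Longrightarrow> \<bar>g i\<bar> \<le> (1::real)"
    "\<And>i j. i < k \<Longrightarrow> j < k \<Longrightarrow> i \<noteq> j \<Longrightarrow> 1/4 \<le> M (\<lambda>l. z i l - z j l)"
    "\<And>i j t. i < k \<Longrightarrow> j < k \<Longrightarrow> i \<noteq> j \<Longrightarrow>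
      1 - \<eta> + 2 * t * (g i - g j) + t\<^sup>2 / 16 \<le> (M (\<lambda>l. x l + t * (z i l - z j l)))\<^sup>2"
proof -
  \<comment> \<open>The bound 2 is the gain of the stretching; the other one is the gain in
    dimension 2k from multiplying the map by 1 / sqrt (1 - \<eta>), which would be admissible if
    there were no near-contact point.\<close>
  define \<tau> where "\<tau> = min 2 ((1 / (1 - \<eta>)) ^ k)"
  have "1 < (1 / (1 - \<eta>)) ^ k" using \<eta> k_pos by (intro one_less_power) auto
  then have "1 < \<tau>" by (simp add: \<tau>_def)
  then obtain a where a: "circumscribed a" "0 < ndet n a" and max: "\<And>a'. circumscribed a' \<Longrightarrow> ndet n a' < \<tau> * ndet n a"
    using near_extremal_circumscribed by blast
  have a_le: "iprod n (mat_app n a y) (mat_app n a y) \<le> (M y)\<^sup>2" for y using a by (simp add: circumscribed_def)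
  have ex: "\<exists>x. M x = 1 \<and> \<not> iprod n (mat_app n a x) (mat_app n a x) \<le> 1 - \<eta>"
  proof (rule ccontr)
    assume "\<not> ?thesis"
    then have c: "\<And>x. M x = 1 \<Longrightarrow> iprod n (mat_app n a x) (mat_app n a x) \<le> 1 - \<eta>" by blast
    let ?c = "1 / sqrt (1 - \<eta>)"
    have "circumscribed (\<lambda>i j. ?c * a i j)"
      unfolding circumscribed_def
    proof
      fix x
      have "iprod n (mat_app n a x) (mat_app n a x) \<le> (1 - \<eta>) * (M x)\<^sup>2"
      proof (cases "M x = 0")
        case True
        then show ?thesis using a_le[of x] by simp
      next
        case False
        have "M (\<lambda>i. (1 / M x) * x i) = 1" using False by (simp only: M_scale) simp
        from c[OF this] have "iprod n (mat_app n a x) (mat_app n a x) / (M x)\<^sup>2 \<le> 1 - \<eta>"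
          by (simp only: mat_app_linear iprod_linear) (simp add: power2_eq_square)
        then show ?thesis using False by (simp add: divide_le_eq mult.commute)
      qed
      then show "iprod n (mat_app n (\<lambda>i j. ?c * a i j) x) (mat_app n (\<lambda>i j. ?c * a i j) x) \<le> (M x)\<^sup>2"
        using \<eta> by (simp only: mat_app_scale_mat iprod_linear) (simp add: divide_le_eq mult.commute)
    qed
    from max[OF this] have "?c ^ n * ndet n a < \<tau> * ndet n a" by (simp only: ndet_scale)
    then have "?c ^ n < \<tau>" using a(2) by (simp only: mult_less_cancel_right_pos)
    moreover have "?c ^ n = (1 / (1 - \<eta>)) ^ k" using \<eta> by (simp add: n_eq power_mult power_divide)
    ultimately show False by (simp add: \<tau>_def)
  qed
  obtain x where x: "M x = 1" "1 - \<eta> \<le> iprod n (mat_app n a x) (mat_app n a x)" using ex by fastforce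
  \<comment> \<open>If the image of every unit vector came within 1/4 of the span of
    \<open>u\<close>, the stretched map would be admissible with at least twice the
    determinant.\<close>
  have step: "\<exists>z. M z = 1 \<and> \<not> iprod n (\<lambda>i. mat_app n a z i - proj n r u (mat_app n a z) i) (\<lambda>i. mat_app n a z i - proj n r u (mat_app n a z) i) \<le> 1 / 16"
    if u: "orthonormal n r u" "r < k" for r u
  proof (rule ccontr)
    let ?y = "\<lambda>z i. mat_app n a z i - proj n r u (mat_app n a z) i"
    assume "\<not> ?thesis"
    then have c: "\<And>x. M x = 1 \<Longrightarrow> iprod n (?y x) (?y x) \<le> 1 / 16" by blast
    have "iprod n (?y z) (?y z) \<le> (M z)\<^sup>2 / 16" for z
    proof (cases "M z = 0")
      case True
      then have "iprod n (mat_app n a z) (mat_app n a z) \<le> 0" using a_le[of z] by simp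
      then have "iprod n (?y z) (?y z) \<le> 0"
        using proj_Pythagoras(1)[OF u(1), of "mat_app n a z"] iprod_nonneg[of n "proj n r u (mat_app n a z)"] by linarith
      then show ?thesis using True by simp
    next
      case False
      have y: "?y (\<lambda>i. (1 / M z) * z i) = (\<lambda>i. (1 / M z) * ?y z i)"
        by (simp only: mat_app_linear proj_scale) (simp add: diff_divide_distrib)
      have "M (\<lambda>i. (1 / M z) * z i) = 1" using False by (simp only: M_scale) simp
      from c[OF this] have "iprod n (?y z) (?y z) / (M z)\<^sup>2 \<le> 1 / 16"
        unfolding y by (simp only: iprod_linear(3,6)) (simp add: power2_eq_square)
      then show ?thesis using False by (simp add: divide_le_eq)
    qed
    from max[OF circumscribed_stretch[OF a(1) u(1) this]]
    have "ndet n (\<lambda>i j. sqrt 8 * contraction r u i j) * ndet n a < \<tau> * ndet n a" by (simp only: ndet_mult)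
    then show False using ndet_stretch[OF u] a(2) by (simp add: \<tau>_def)
  qed
  \<comment> \<open>A Gram-Schmidt process on the images \<open>a (z i)\<close>. The last clause
    says dually that each image lies in the span of the chosen \<open>u j\<close>; it keeps every
    later direction orthogonal to the earlier images.\<close>
  have "\<exists>z u. orthonormal n r u \<and> (\<forall>i<r. M (z i) = 1 \<and> 1/4 \<le> iprod n (u i) (mat_app n a (z i)) \<and>
      (\<forall>j<r. i < j \<longrightarrow> iprod n (u j) (mat_app n a (z i)) = 0) \<and>
      (\<forall>w. (\<forall>j<r. iprod n w (u j) = 0) \<longrightarrow> iprod n w (mat_app n a (z i)) = 0))" if "r \<le> k" for r
    using that
  proof (induction r)
    case 0
    show ?case by (intro exI) (simp add: orthonormal_def)
  next
    case (Suc r)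
    then have "r \<le> k" by simp
    from Suc.IH[OF this] obtain z u where u: "orthonormal n r u"
      and z: "\<And>i. i < r \<Longrightarrow> M (z i) = 1" "\<And>i. i < r \<Longrightarrow> 1/4 \<le> iprod n (u i) (mat_app n a (z i))"
        "\<And>i j. i < r \<Longrightarrow> j < r \<Longrightarrow> i < j \<Longrightarrow> iprod n (u j) (mat_app n a (z i)) = 0"
        "\<And>i w. i < r \<Longrightarrow> (\<And>j. j < r \<Longrightarrow> iprod n w (u j) = 0) \<Longrightarrow> iprod n w (mat_app n a (z i)) = 0"
      by blast
    let ?y = "\<lambda>z i. mat_app n a z i - proj n r u (mat_app n a z) i"
    obtain v where v: "M v = 1" "1/16 < iprod n (?y v) (?y v)"
      using step[OF u] Suc.prems by fastforce
    define s where "s = sqrt (iprod n (?y v) (?y v))"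
    have s2: "s * s = iprod n (?y v) (?y v)" by (simp add: s_def)
    have "sqrt (1/16) < s" unfolding s_def using v(2) by (simp only: real_sqrt_less_iff)
    then have s: "1/4 < s" by (simp add: real_sqrt_divide)
    define w where "w = (\<lambda>i. (1 / s) * ?y v i)"
    have w1: "iprod n w w = 1" unfolding w_def iprod_linear(3,6) s2[symmetric] using s by simp
    have w0: "iprod n w (u j) = 0" if "j < r" for j
      unfolding w_def iprod_linear(3) using proj_Pythagoras(3)[OF u that, of "mat_app n a v"] by simp
    have av: "iprod n b (mat_app n a v) = s * iprod n b w + iprod n b (proj n r u (mat_app n a v))" for b
      unfolding w_def iprod_linear(5,6) using s by simp
    have bP: "iprod n b (proj n r u (mat_app n a v)) = 0" if "\<And>j. j < r \<Longrightarrow> iprod n b (u j) = 0" for b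
      using that by (simp add: iprod_proj)
    have wv: "iprod n w (mat_app n a v) = s" using av[of w] w1 bP[of w] w0 by simp
    let ?u = "u(r := w)" and ?z = "z(r := v)"
    have "M (?z i) = 1 \<and> 1/4 \<le> iprod n (?u i) (mat_app n a (?z i)) \<and>
        (\<forall>j<Suc r. i < j \<longrightarrow> iprod n (?u j) (mat_app n a (?z i)) = 0) \<and>
        (\<forall>b. (\<forall>j<Suc r. iprod n b (?u j) = 0) \<longrightarrow> iprod n b (mat_app n a (?z i)) = 0)" if i: "i < Suc r" for i
    proof (cases "i = r")
      case True
      have "iprod n b (mat_app n a v) = 0" if b: "\<forall>j<Suc r. iprod n b (?u j) = 0" for b
      proof -
        have "iprod n b (u j) = 0" if "j < r" for j using b[rule_format, of j] that by simp
        moreover have "iprod n b w = 0" using b[rule_format, of r] by simp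
        ultimately show ?thesis using av[of b] bP[of b] by simp
      qed
      then have b0: "\<forall>b. (\<forall>j<Suc r. iprod n b (?u j) = 0) \<longrightarrow> iprod n b (mat_app n a v) = 0" by blast
      have "?z i = v" "?u i = w" using True by simp_all
      then show ?thesis using b0 v(1) wv s True by (intro conjI) (simp_all only: less_Suc_eq, auto)
    next
      case False
      then have ir: "i < r" using i by simp
      have "iprod n (?u j) (mat_app n a (z i)) = 0" if "j < Suc r" "i < j" for j
      proof (cases "j = r")
        case True
        then show ?thesis using z(4)[OF ir w0] by simp
      next
        case False
        then show ?thesis using z(3)[OF ir _ that(2)] that(1) by simp
      qed
      then have "\<forall>j<Suc r. i < j \<longrightarrow> iprod n (?u j) (mat_app n a (z i)) = 0" by blast
      moreover have "iprod n b (mat_app n a (z i)) = 0" if b: "\<forall>j<Suc r. iprod n b (?u j) = 0" for b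
      proof (rule z(4)[OF ir])
        show "iprod n b (u j) = 0" if "j < r" for j using b[rule_format, of j] that by simp
      qed
      then have "\<forall>b. (\<forall>j<Suc r. iprod n b (?u j) = 0) \<longrightarrow> iprod n b (mat_app n a (z i)) = 0" by blast
      moreover have "?z i = z i" "?u i = u i" using False by simp_all
      ultimately show ?thesis using z(1,2)[OF ir] by (metis (no_types))
    qed
    with iprod_extend_orthonormal[OF u w1 w0] have "orthonormal n (Suc r) ?u \<and> (\<forall>i<Suc r. M (?z i) = 1 \<and>
      1/4 \<le> iprod n (?u i) (mat_app n a (?z i)) \<and>
      (\<forall>j<Suc r. i < j \<longrightarrow> iprod n (?u j) (mat_app n a (?z i)) = 0) \<and>
      (\<forall>b. (\<forall>j<Suc r. iprod n b (?u j) = 0) \<longrightarrow> iprod n b (mat_app n a (?z i)) = 0))" by blast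
    then show ?case by blast
  qed
  from this[OF order_refl] obtain z u where u: "orthonormal n k u" and z: "\<And>i. i < k \<Longrightarrow> M (z i) = 1"
      and z1: "\<And>i. i < k \<Longrightarrow> 1/4 \<le> iprod n (u i) (mat_app n a (z i))"
      and z0: "\<And>i j. i < k \<Longrightarrow> j < k \<Longrightarrow> i < j \<Longrightarrow> iprod n (u j) (mat_app n a (z i)) = 0"
    by blast
  \<comment> \<open>Testing against the direction of the larger index annihilates the image of the
    other vector and leaves at least 1/4; Cauchy-Schwarz does the rest.\<close>
  have sep1: "1/16 \<le> iprod n (mat_app n a (\<lambda>l. z i l - z j l)) (mat_app n a (\<lambda>l. z i l - z j l))"
    if "i < k" "j < k" "j < i" for i j
  proof -
    let ?d = "mat_app n a (\<lambda>l. z i l - z j l)"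
    have "1/4 \<le> iprod n (u i) ?d"
      unfolding mat_app_linear iprod_linear using z0[of j i] z1[of i] that by simp
    then have "(1/4)\<^sup>2 \<le> (iprod n (u i) ?d)\<^sup>2" by (intro power_mono) auto
    also have "\<dots> \<le> 1 * iprod n ?d ?d"
      using iprod_Cauchy_Schwarz[of n "u i" ?d] u that by (simp add: orthonormal_def)
    finally show ?thesis by (simp add: power2_eq_square)
  qed
  have sep: "1/16 \<le> iprod n (mat_app n a (\<lambda>l. z i l - z j l)) (mat_app n a (\<lambda>l. z i l - z j l))"
    if "i < k" "j < k" "i \<noteq> j" for i j
  proof (cases "j < i")
    case False
    then have "1/16 \<le> iprod n (mat_app n a (\<lambda>l. z j l - z i l)) (mat_app n a (\<lambda>l. z j l - z i l))"
      using sep1[of j i] that by simp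
    also have "\<dots> = iprod n (mat_app n a (\<lambda>l. z i l - z j l)) (mat_app n a (\<lambda>l. z i l - z j l))"
      by (simp only: mat_app_linear iprod_linear)
    finally show ?thesis .
  qed (use sep1 that in auto)
  define g where "g i = iprod n (mat_app n a x) (mat_app n a (z i))" for i
  show ?thesis
  proof
    show "M x = 1" by fact
    show "M (z i) = 1" if "i < k" for i using z[OF that] .
    show "\<bar>g i\<bar> \<le> 1" if "i < k" for i
      unfolding g_def using a_le[of x] a_le[of "z i"] x(1) z[OF that] by (intro iprod_abs_le) auto
    fix i j assume ij: "i < k" "j < k" "i \<noteq> j"
    let ?d = "\<lambda>l. z i l - z j l"
    have "(1/4)\<^sup>2 \<le> (M ?d)\<^sup>2" using sep[OF ij] a_le[of ?d] by (simp add: power2_eq_square)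
    then show "1/4 \<le> M ?d" using power2_le_imp_le[of "1/4" "M ?d"] by simp
    fix t
    have "iprod n (mat_app n a (\<lambda>l. x l + t * ?d l)) (mat_app n a (\<lambda>l. x l + t * ?d l)) =
        iprod n (mat_app n a x) (mat_app n a x) + 2 * t * iprod n (mat_app n a x) (mat_app n a ?d) + t\<^sup>2 * iprod n (mat_app n a ?d) (mat_app n a ?d)"
      unfolding mat_app_linear(1)[of n a x] mat_app_linear(3) by (rule iprod_square_add)
    moreover have "iprod n (mat_app n a x) (mat_app n a ?d) = g i - g j"
      by (simp only: mat_app_linear iprod_linear g_def)
    moreover have "t\<^sup>2 / 16 \<le> t\<^sup>2 * iprod n (mat_app n a ?d) (mat_app n a ?d)"
      using mult_left_mono[OF sep[OF ij], of "t\<^sup>2"] by simp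
    ultimately show "1 - \<eta> + 2 * t * (g i - g j) + t\<^sup>2 / 16 \<le> (M (\<lambda>l. x l + t * ?d l))\<^sup>2"
      using x(2) a_le[of "\<lambda>l. x l + t * ?d l"] by simp
  qed
qed

text \<open>The \<open>z i\<close> are images of orthonormal vectors u_i, so a sum over
  \<open>S\<close> is the image of a vector of squared length card S, and 2 t^2 comes from |u_i -
  u_j|^2 = 2. The point \<open>x\<close> is the normalised image of a unit vector y at which the
  ellipsoid almost touches the ball, and \<open>g i\<close> is the inner product of y with
  u_i.\<close>

lemma Dvoretzky_Rogers_inscribed:
  assumes \<eta>: "0 < \<eta>" "\<eta> < 1"
  obtains x z g where "M x = 1" "\<And>i. i < k \<Longrightarrow> 1/4 \<le> M (z i)" "\<And>i. i < k \<Longrightarrow> M (z i) \<le> 1"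
    "\<And>i. i < k \<Longrightarrow> \<bar>g i\<bar> \<le> (1::real)"
    "\<And>S. S \<subseteq> {..<k} \<Longrightarrow> (M (\<lambda>l. \<Sum>i\<in>S. z i l))\<^sup>2 \<le> card S"
    "\<And>i j t. i < k \<Longrightarrow> j < k \<Longrightarrow> i \<noteq> j \<Longrightarrow>
      (M (\<lambda>l. x l + t * (z i l - z j l)))\<^sup>2 \<le> (1 + 2 * \<bar>t\<bar> * \<bar>g i - g j\<bar> + 2 * t\<^sup>2) / (1 - \<eta>)"
proof -
  define \<tau> where "\<tau> = min 2 ((1 / (1 - \<eta>)) ^ k)"
  have "1 < (1 / (1 - \<eta>)) ^ k" using \<eta> k_pos by (intro one_less_power) auto
  then have "1 < \<tau>" by (simp add: \<tau>_def)
  then obtain a where a: "inscribed a" "0 < ndet n a" and max: "\<And>a'. inscribed a' \<Longrightarrow> ndet n a' < \<tau> * ndet n a"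
    using near_extremal_inscribed by blast
  have a_le: "(M (mat_app n a y))\<^sup>2 \<le> iprod n y y" for y using a by (simp add: inscribed_def)
  have ex: "\<exists>y. iprod n y y = 1 \<and> \<not> (M (mat_app n a y))\<^sup>2 \<le> 1 - \<eta>"
  proof (rule ccontr)
    assume "\<not> ?thesis"
    then have c: "\<And>y. iprod n y y = 1 \<Longrightarrow> (M (mat_app n a y))\<^sup>2 \<le> 1 - \<eta>" by blast
    let ?c = "1 / sqrt (1 - \<eta>)"
    have "inscribed (\<lambda>i j. ?c * a i j)"
      unfolding inscribed_def
    proof
      fix y
      have "(M (mat_app n a y))\<^sup>2 \<le> (1 - \<eta>) * iprod n y y"
      proof (cases "iprod n y y = 0")
        case True
        then show ?thesis using a_le[of y] by simp
      next
        case False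
        let ?s = "1 / sqrt (iprod n y y)"
        have "iprod n (\<lambda>i. ?s * y i) (\<lambda>i. ?s * y i) = 1"
          using False by (simp only: iprod_linear) simp
        from c[OF this] have "(M (mat_app n a y))\<^sup>2 / iprod n y y \<le> 1 - \<eta>"
          by (simp only: mat_app_linear M_scale power_mult_distrib) (simp add: power_divide)
        then show ?thesis using False iprod_nonneg[of n y] by (simp add: divide_le_eq mult.commute)
      qed
      then show "(M (mat_app n (\<lambda>i j. ?c * a i j) y))\<^sup>2 \<le> iprod n y y"
        using \<eta> by (simp only: mat_app_scale_mat M_scale power_mult_distrib)
          (simp add: power_divide divide_le_eq mult.commute)
    qed
    from max[OF this] have "?c ^ n * ndet n a < \<tau> * ndet n a" by (simp only: ndet_scale)
    then have "?c ^ n < \<tau>" using a(2) by (simp only: mult_less_cancel_right_pos)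
    moreover have "?c ^ n = (1 / (1 - \<eta>)) ^ k" using \<eta> by (simp add: n_eq power_mult power_divide)
    ultimately show False by (simp add: \<tau>_def)
  qed
  obtain y where y: "iprod n y y = 1" "1 - \<eta> \<le> (M (mat_app n a y))\<^sup>2" using ex by fastforce
  \<comment> \<open>If all unit vectors orthogonal to \<open>u\<close> had images of norm at most
    1/4, the stretched map would again beat the near-maximal determinant.\<close>
  have step: "\<exists>w. iprod n w w = 1 \<and> (\<forall>j<r. iprod n w (u j) = 0) \<and> \<not> (M (mat_app n a w))\<^sup>2 \<le> 1 / 16"
    if u: "orthonormal n r u" "r < k" for r u
  proof (rule ccontr)
    assume "\<not> ?thesis"
    then have c: "\<And>w. iprod n w w = 1 \<Longrightarrow> (\<And>j. j < r \<Longrightarrow> iprod n w (u j) = 0) \<Longrightarrow> (M (mat_app n a w))\<^sup>2 \<le> 1 / 16" by blast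
    have "(M (mat_app n a w))\<^sup>2 \<le> iprod n w w / 16" if w0: "\<And>j. j < r \<Longrightarrow> iprod n w (u j) = 0" for w
    proof (cases "iprod n w w = 0")
      case True
      then show ?thesis using a_le[of w] by simp
    next
      case False
      let ?s = "1 / sqrt (iprod n w w)"
      have "iprod n (\<lambda>i. ?s * w i) (\<lambda>i. ?s * w i) = 1"
        using False by (simp only: iprod_linear) simp
      moreover have "iprod n (\<lambda>i. ?s * w i) (u j) = 0" if "j < r" for j
        using w0[OF that] by (simp only: iprod_linear mult_zero_right)
      ultimately have "(M (mat_app n a (\<lambda>i. ?s * w i)))\<^sup>2 \<le> 1 / 16" by (rule c)
      then have "(M (mat_app n a w))\<^sup>2 / iprod n w w \<le> 1 / 16"
        by (simp only: mat_app_linear M_scale power_mult_distrib) (simp add: power_divide)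
      then show ?thesis using False iprod_nonneg[of n w] by (simp add: divide_le_eq)
    qed
    from max[OF inscribed_stretch[OF a(1) u(1) this]]
    have "ndet n a * ndet n (\<lambda>i j. sqrt 8 * contraction r u i j) < \<tau> * ndet n a" by (simp only: ndet_mult)
    then show False using ndet_stretch[OF u] a(2) by (simp add: \<tau>_def mult.commute)
  qed
  have "\<exists>u. orthonormal n r u \<and> (\<forall>i<r. 1/4 \<le> M (mat_app n a (u i)))" if "r \<le> k" for r
    using that
  proof (induction r)
    case 0
    show ?case by (intro exI) (simp add: orthonormal_def)
  next
    case (Suc r)
    then obtain u where u: "orthonormal n r u" "\<forall>i<r. 1/4 \<le> M (mat_app n a (u i))" by auto
    obtain w where w: "iprod n w w = 1" "\<forall>j<r. iprod n w (u j) = 0" "1/16 < (M (mat_app n a w))\<^sup>2"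
      using step[OF u(1)] Suc.prems by fastforce
    have "1/4 \<le> M (mat_app n a w)"
      using w(3) power2_le_imp_le[of "1/4" "M (mat_app n a w)"] by (simp add: power_divide)
    then have "orthonormal n (Suc r) (u(r := w)) \<and> (\<forall>i<Suc r. 1/4 \<le> M (mat_app n a ((u(r := w)) i)))"
      using u w iprod_extend_orthonormal[OF u(1) w(1)] by (simp add: less_Suc_eq)
    then show ?case by blast
  qed
  from this[OF order_refl] obtain u where u: "orthonormal n k u"
    and u1: "\<And>i. i < k \<Longrightarrow> 1/4 \<le> M (mat_app n a (u i))"
    by blast
  have uu: "iprod n (u i) (u j) = (if i = j then 1 else 0)" if "i < k" "j < k" for i j
    using u that by (simp add: orthonormal_def)
  define m where "m = M (mat_app n a y)"
  have m: "0 < m" "m \<le> 1" "1 - \<eta> \<le> m\<^sup>2"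
  proof -
    show "1 - \<eta> \<le> m\<^sup>2" using y by (simp add: m_def)
    show "m \<le> 1" using power2_le_imp_le[of m 1] a_le[of y] y(1) by (simp add: m_def)
    have "m \<noteq> 0" using \<open>1 - \<eta> \<le> m\<^sup>2\<close> \<eta> by auto
    then show "0 < m" using M_nonneg[of "mat_app n a y"] unfolding m_def by linarith
  qed
  define x where "x = (\<lambda>i. (1 / m) * mat_app n a y i)"
  define g where "g i = iprod n y (u i)" for i
  show ?thesis
  proof (rule that[of x "\<lambda>i. mat_app n a (u i)" g])
    show "M x = 1" unfolding x_def M_scale using m by (simp add: m_def)
    fix i assume i: "i < k"
    show "1/4 \<le> M (mat_app n a (u i))" using u1 i .
    show "M (mat_app n a (u i)) \<le> 1" using power2_le_imp_le[of "M (mat_app n a (u i))" 1] a_le[of "u i"] uu[OF i i] by simp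
    show "\<bar>g i\<bar> \<le> 1" unfolding g_def using y(1) uu[OF i i] by (intro iprod_abs_le) auto
  next
    fix S assume S: "S \<subseteq> {..<k}"
    have "(M (\<lambda>l. \<Sum>i\<in>S. mat_app n a (u i) l))\<^sup>2 \<le> iprod n (\<lambda>l. \<Sum>i\<in>S. u i l) (\<lambda>l. \<Sum>i\<in>S. u i l)"
      using a_le[of "\<lambda>l. \<Sum>i\<in>S. u i l"] by (simp add: mat_app_sum)
    also have "\<dots> = (\<Sum>i\<in>S. \<Sum>j\<in>S. iprod n (u i) (u j))"
      unfolding iprod_sum_right by (intro sum.cong refl) (subst iprod_commute, simp add: iprod_sum_right iprod_commute)
    also have "\<dots> = (\<Sum>i\<in>S. \<Sum>j\<in>S. if i = j then 1 else 0)"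
      using S by (intro sum.cong refl uu) auto
    also have "\<dots> = card S" using finite_subset[OF S] by simp
    finally show "(M (\<lambda>l. \<Sum>i\<in>S. mat_app n a (u i) l))\<^sup>2 \<le> card S" .
  next
    fix i j t assume ij: "i < k" "j < k" "i \<noteq> j"
    \<comment> \<open>Normalising \<open>x\<close> by the factor 1/m turns the parameter
      \<open>t\<close> into \<open>m * t\<close> on the Euclidean side and costs 1/m^2 \<le> 1/(1 -
      \<eta>) in the square. Absolute values allow m \<le> 1 to be used whatever the sign of
      \<open>g i - g j\<close>.\<close>
    let ?d = "\<lambda>l. u i l - u j l" and ?t = "m * t"
    let ?v = "\<lambda>l. y l + ?t * ?d l"
    have eq: "(\<lambda>l. x l + t * (mat_app n a (u i) l - mat_app n a (u j) l)) = (\<lambda>l. (1 / m) * mat_app n a ?v l)"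
      unfolding x_def mat_app_linear(1)[of n a y] mat_app_linear(3) mat_app_linear(2)
      using m(1) by (intro ext) (simp add: distrib_left)
    have "iprod n ?v ?v = iprod n y y + 2 * ?t * iprod n y ?d + ?t\<^sup>2 * iprod n ?d ?d"
      by (rule iprod_square_add)
    also have "iprod n ?d ?d = 2" using ij by (simp add: iprod_linear uu)
    also have "iprod n y ?d = g i - g j" by (simp add: iprod_linear g_def)
    finally have v: "iprod n ?v ?v = 1 + 2 * ?t * (g i - g j) + ?t\<^sup>2 * 2" using y by simp
    have "?t * (g i - g j) \<le> \<bar>?t\<bar> * \<bar>g i - g j\<bar>"
      by (metis abs_ge_self abs_mult)
    also have "\<dots> \<le> \<bar>t\<bar> * \<bar>g i - g j\<bar>"
      using m mult_right_mono[of m 1 "\<bar>t\<bar>"] by (intro mult_right_mono) (simp_all add: abs_mult)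
    finally have 1: "?t * (g i - g j) \<le> \<bar>t\<bar> * \<bar>g i - g j\<bar>" .
    have "m\<^sup>2 \<le> 1" using m by (simp add: power_le_one)
    then have 2: "?t\<^sup>2 \<le> t\<^sup>2" using mult_right_mono[of "m\<^sup>2" 1 "t\<^sup>2"] by (simp add: power_mult_distrib)
    have "(M (mat_app n a ?v))\<^sup>2 \<le> 1 + 2 * \<bar>t\<bar> * \<bar>g i - g j\<bar> + 2 * t\<^sup>2" (is "_ \<le> ?R")
      using a_le[of ?v] v 1 2 by simp
    then have "(M (mat_app n a ?v))\<^sup>2 / m\<^sup>2 \<le> ?R / (1 - \<eta>)"
      using m(3) \<eta> by (rule_tac frac_le) simp_all
    then show "(M (\<lambda>l. x l + t * (mat_app n a (u i) l - mat_app n a (u j) l)))\<^sup>2 \<le> ?R / (1 - \<eta>)"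
      unfolding eq M_scale by (simp add: power_mult_distrib power_divide)
  qed
qed

end

subsection \<open>Real normed fields are locally compact\<close>

definition real_poly_eval :: "'a::{real_algebra_1,comm_ring_1} \<Rightarrow> real poly \<Rightarrow> 'a" where
  "real_poly_eval x P = poly (map_poly of_real P) x"

lemma real_poly_eval_simps [simp]:
  "real_poly_eval x 0 = 0" "real_poly_eval x 1 = 1" "real_poly_eval x (pCons a P) = of_real a + x * real_poly_eval x P"
  by (simp_all add: real_poly_eval_def map_poly_pCons map_poly_1)

lemma real_poly_eval_add: "real_poly_eval x (P + Q) = real_poly_eval x P + real_poly_eval x Q"
proof (induction P arbitrary: Q)
  case (pCons a P)
  then show ?case by (cases Q) (simp add: algebra_simps)
qed simp

lemma real_poly_eval_smult: "real_poly_eval x (Polynomial.smult c P) = of_real c * real_poly_eval x P"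
  by (induction P) (simp_all add: algebra_simps)

lemma real_poly_eval_mult: "real_poly_eval x (P * Q) = real_poly_eval x P * real_poly_eval x Q"
  by (induction P) (simp_all add: real_poly_eval_add real_poly_eval_smult algebra_simps)

lemma real_poly_eval_power: "real_poly_eval x (P ^ n) = real_poly_eval x P ^ n"
  by (induction n) (simp_all add: real_poly_eval_mult)

lemma degree_map_of_real: "degree (map_poly of_real P :: 'a::{real_algebra_1,comm_ring_1} poly) = degree P"
  by (rule degree_map_poly) auto

lemma real_poly_has_root:
  assumes "degree P \<noteq> 0"
  obtains \<alpha> :: complex where "real_poly_eval \<alpha> P = 0"
  using fundamental_theorem_of_algebra[of "map_poly of_real P"] assms that
  unfolding constant_degree degree_map_of_real real_poly_eval_def by metis

text \<open>The monic real polynomial X^2 - 2 Re(z) X + |z|^2 whose roots are \<open>z\<close> and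
  its conjugate.\<close>

definition quad :: "complex \<Rightarrow> real poly" where
  "quad z = [:(Re z)\<^sup>2 + (Im z)\<^sup>2, - 2 * Re z, 1:]"

lemma degree_quad: "degree (quad z) = 2" "lead_coeff (quad z) = 1"
  by (simp_all add: quad_def)

lemma real_poly_eval_quad_root: "real_poly_eval z (quad z) = 0"
  by (simp add: quad_def complex_eq_iff power2_eq_square algebra_simps)

text \<open>The remainder is a real polynomial of degree at most 1 that vanishes at a non-real
  point, hence it is zero.\<close>

lemma quad_dvd:
  assumes "real_poly_eval \<alpha> P = 0" "Im \<alpha> \<noteq> 0"
  shows "quad \<alpha> dvd P"
proof -
  let ?R = "P mod quad \<alpha>"
  have "real_poly_eval \<alpha> ?R = 0"
    using assms(1) real_poly_eval_add[of \<alpha> "P div quad \<alpha> * quad \<alpha>" ?R] by (simp add: real_poly_eval_mult real_poly_eval_quad_root)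
  moreover have "quad \<alpha> \<noteq> 0" by (simp add: quad_def)
  from degree_mod_less[OF this, of P] have d: "degree ?R < 2"
    using degree_quad(1)[of \<alpha>] by auto
  define a b where "a = coeff ?R 0" and "b = coeff ?R 1"
  have R: "?R = [:a, b:]"
    unfolding a_def b_def using d
    by (intro poly_eqI) (auto simp: coeff_pCons coeff_eq_0 split: nat.splits)
  ultimately have "b = 0 \<and> a = 0"
    using assms(2) by (auto simp: complex_eq_iff)
  then show ?thesis using R by (simp add: dvd_eq_mod_eq_0)
qed

text \<open>A monic real polynomial is a product of monic linear factors and polynomials
  \<open>quad \<alpha>\<close>. The square of a linear factor is itself a \<open>quad\<close> of a
  real number, so such a factor is only bounded below by the square root of \<open>m\<close>; this
  is why the norm is squared.\<close>

lemma norm_ev_ge: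
  fixes x :: "'k::real_normed_field"
  assumes m: "0 < m" and ge: "\<And>z. m \<le> norm (real_poly_eval x (quad z))" and "lead_coeff P = 1"
  shows "m ^ degree P \<le> (norm (real_poly_eval x P))\<^sup>2"
  using assms(3)
proof (induction "degree P" arbitrary: P rule: less_induct)
  case less
  show ?case
  proof (cases "degree P = 0")
    case True
    then obtain c where "P = [:c:]" by (meson degree_eq_zeroE)
    then show ?thesis using less.prems by simp
  next
    case False
    then obtain \<alpha> :: complex where \<alpha>: "real_poly_eval \<alpha> P = 0" by (rule real_poly_has_root)
    have "\<exists>F Q. P = F * Q \<and> lead_coeff F = 1 \<and> 0 < degree F \<and> m ^ degree F \<le> (norm (real_poly_eval x F))\<^sup>2"
    proof (cases "Im \<alpha> = 0")
      case True
      let ?a = "Re \<alpha>" and ?F = "[:- Re \<alpha>, 1:]"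
      have "\<alpha> = of_real ?a" using True by (simp add: complex_eq_iff)
      moreover have "real_poly_eval (of_real a :: complex) R = of_real (poly R a)" for a R
        by (induction R) simp_all
      ultimately have "poly P ?a = 0" using \<alpha> by (metis of_real_eq_0_iff)
      then obtain Q where Q: "P = ?F * Q" by (auto simp: poly_eq_0_iff_dvd elim: dvdE)
      have "real_poly_eval x (quad (of_real ?a)) = (real_poly_eval x ?F)\<^sup>2"
        by (simp add: quad_def power2_eq_square algebra_simps)
      then have "m \<le> (norm (real_poly_eval x ?F))\<^sup>2" using ge[of "of_real ?a"] by (simp add: norm_power)
      then show ?thesis using Q by (intro exI[of _ ?F] exI[of _ Q]) simp
    next
      case False
      then obtain Q where Q: "P = quad \<alpha> * Q" using quad_dvd[OF \<alpha>] by (auto elim: dvdE)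
      have "m\<^sup>2 \<le> (norm (real_poly_eval x (quad \<alpha>)))\<^sup>2" using m ge[of \<alpha>] by (intro power_mono) auto
      then show ?thesis using Q degree_quad[of \<alpha>] by (intro exI[of _ "quad \<alpha>"] exI[of _ Q]) simp
    qed
    then obtain F Q where FQ: "P = F * Q" "lead_coeff F = 1" "0 < degree F" "m ^ degree F \<le> (norm (real_poly_eval x F))\<^sup>2"
      by blast
    have Q: "lead_coeff Q = 1" using less.prems FQ by (simp add: lead_coeff_mult)
    have "F \<noteq> 0" "Q \<noteq> 0" using FQ(2) Q by auto
    then have d: "degree P = degree F + degree Q" unfolding FQ(1) by (rule degree_mult_eq)
    have "m ^ degree Q \<le> (norm (real_poly_eval x Q))\<^sup>2" using d FQ(3) Q by (intro less.hyps) auto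
    then have "m ^ degree F * m ^ degree Q \<le> (norm (real_poly_eval x F))\<^sup>2 * (norm (real_poly_eval x Q))\<^sup>2"
      using FQ(4) m by (intro mult_mono) auto
    then show ?thesis unfolding d by (simp add: power_add FQ(1) real_poly_eval_mult norm_mult power_mult_distrib)
  qed
qed

text \<open>This sum is the cofactor of g - c in g^(n+1) - c^(n+1). Being monic of degree 2n, it is
  subject to the lower bound for values of monic polynomials.\<close>

lemma monic_geometric_sum:
  fixes g :: "real poly"
  assumes "lead_coeff g = 1" "degree g = 2"
  shows "degree (\<Sum>i\<le>n. Polynomial.smult (c ^ (n - i)) (g ^ i)) = 2 * n \<and> lead_coeff (\<Sum>i\<le>n. Polynomial.smult (c ^ (n - i)) (g ^ i)) = 1"
proof (induction n)
  case (Suc n)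
  let ?S = "\<lambda>n. \<Sum>i\<le>n. Polynomial.smult (c ^ (n - i)) (g ^ i)"
  have eq: "?S (Suc n) = g ^ Suc n + Polynomial.smult c (?S n)"
  proof -
    have "Polynomial.smult c (\<Sum>i\<in>A. h i) = (\<Sum>i\<in>A. Polynomial.smult c (h i))" if "finite A" for h :: "nat \<Rightarrow> real poly" and A
      using that by induction (simp_all add: Polynomial.smult_add_right)
    then show ?thesis by (simp add: Suc_diff_le)
  qed
  have "g \<noteq> 0" using assms by auto
  then have g: "degree (g ^ Suc n) = 2 * Suc n" "lead_coeff (g ^ Suc n) = 1"
    using assms degree_power_eq[of g "Suc n"] lead_coeff_power[of g "Suc n"] by (auto simp del: power_Suc)
  have lt: "degree (Polynomial.smult c (?S n)) < degree (g ^ Suc n)"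
    unfolding g(1) by (rule le_less_trans[OF degree_smult_le]) (simp add: conjunct1[OF Suc.IH])
  have "degree (?S (Suc n)) = 2 * Suc n"
    unfolding eq degree_add_eq_left[OF lt] by (rule g(1))
  moreover have "lead_coeff (?S (Suc n)) = 1"
    unfolding eq add.commute[of "g ^ Suc n"] lead_coeff_add_le[OF lt] by (rule g(2))
  ultimately show ?case ..
qed simp

text \<open>
  Ostrowski's argument: for \<open>w\<close> of minimal norm, \<open>w ^ n - c ^ n\<close> is \<open>w - c\<close> times the value of a monic
  real polynomial, whose norm is at least \<open>m ^ (n - 1)\<close>; let \<open>n\<close> tend to infinity.
\<close>

lemma norm_shift_le:
  fixes x :: "'k::real_normed_field"
  assumes m: "0 < m" and ge: "\<And>z. m \<le> norm (real_poly_eval x (quad z))"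
    and g: "lead_coeff g = 1" "degree g = 2" and gm: "norm (real_poly_eval x g) = m" and c: "\<bar>c\<bar> < m"
  shows "norm (real_poly_eval x g - of_real c) \<le> m"
proof -
  let ?w = "real_poly_eval x g"
  have "norm (?w - of_real c) \<le> m + m * (\<bar>c\<bar> / m) ^ Suc n" for n
  proof -
    let ?S = "\<Sum>i\<le>n. Polynomial.smult (c ^ (n - i)) (g ^ i)"
    have real_poly_eval_S: "real_poly_eval x ?S = (\<Sum>i\<le>n. ?w ^ i * of_real c ^ (n - i))"
    proof -
      have "real_poly_eval x (\<Sum>i\<in>A. Polynomial.smult (c ^ (n - i)) (g ^ i)) = (\<Sum>i\<in>A. ?w ^ i * of_real c ^ (n - i))" if "finite A" for A
        using that by induction (simp_all add: real_poly_eval_add real_poly_eval_smult real_poly_eval_power mult.commute)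
      then show ?thesis by simp
    qed
    have "(m ^ n)\<^sup>2 \<le> (norm (real_poly_eval x ?S))\<^sup>2"
      using norm_ev_ge[OF m ge, of ?S] monic_geometric_sum[OF g, of c n]
      by (metis power_even_eq)
    then have S: "m ^ n \<le> norm (real_poly_eval x ?S)" by (rule power2_le_imp_le) simp
    have "?w ^ Suc n - of_real c ^ Suc n = (?w - of_real c) * real_poly_eval x ?S"
      unfolding real_poly_eval_S by (simp only: power_diff_sumr2 lessThan_Suc_atMost)
        (simp add: mult.commute)
    then have "norm (?w - of_real c) * norm (real_poly_eval x ?S) = norm (?w ^ Suc n - of_real c ^ Suc n)"
      by (simp only: norm_mult)
    also have "\<dots> \<le> m ^ Suc n + \<bar>c\<bar> ^ Suc n"
      using norm_triangle_ineq4[of "?w ^ Suc n" "of_real c ^ Suc n"] by (simp only: norm_power gm norm_of_real)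
    finally have "norm (?w - of_real c) * m ^ n \<le> m ^ Suc n + \<bar>c\<bar> ^ Suc n"
      using mult_left_mono[OF S, of "norm (?w - of_real c)"] by simp
    then have "norm (?w - of_real c) \<le> (m ^ Suc n + \<bar>c\<bar> ^ Suc n) / m ^ n"
      using m by (simp add: le_divide_eq)
    also have "\<dots> = m + m * (\<bar>c\<bar> / m) ^ Suc n" using m by (simp add: add_divide_distrib power_divide)
    finally show ?thesis .
  qed
  moreover have "(\<lambda>n. m + m * (\<bar>c\<bar> / m) ^ Suc n) \<longlonglongrightarrow> m + m * 0"
    using m c by (intro tendsto_intros LIMSEQ_Suc LIMSEQ_power_zero) auto
  ultimately show ?thesis
    using LIMSEQ_le_const by fastforce
qed

text \<open>The norm of the value of \<open>quad z\<close> at \<open>x\<close> attains its minimum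
  over \<open>z\<close>. If the minimum \<open>m\<close> were positive, subtracting m/2 repeatedly
  from the minimal value would never change its norm, although the value moves arbitrarily
  far.\<close>

lemma real_normed_field_quadratic:
  fixes x :: "'k::real_normed_field"
  obtains z where "real_poly_eval x (quad z) = 0"
proof -
  let ?f = "\<lambda>z. norm (real_poly_eval x (quad z))"
  have f: "?f = (\<lambda>z. norm (of_real ((cmod z)\<^sup>2) + x * (of_real (- 2 * Re z) + x)))"
    by (simp add: quad_def cmod_power2)
  \<comment> \<open>Outside this ball the value is at least |z|^2 - |x| (2 |z| + |x|), which already
    exceeds the value |x|^2 taken at z = 0 or equals it, so the minimum over the ball is
    global.\<close>
  have "continuous_on (cball 0 (4 * norm x)) ?f"
    unfolding f by (intro continuous_intros)
  then have "\<exists>z0\<in>cball 0 (4 * norm x). \<forall>z\<in>cball 0 (4 * norm x). ?f z0 \<le> ?f z"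
    by (intro continuous_attains_inf) auto
  then obtain z0 where z0: "\<And>z. z \<in> cball 0 (4 * norm x) \<Longrightarrow> ?f z0 \<le> ?f z"
    by blast
  have min: "?f z0 \<le> ?f z" for z
  proof (cases "z \<in> cball 0 (4 * norm x)")
    case False
    then have z: "4 * norm x \<le> cmod z" by simp
    have "?f z0 \<le> ?f 0" by (rule z0) simp
    also have "?f 0 = norm x * norm x" by (simp add: quad_def norm_mult)
    also have "\<dots> \<le> (cmod z)\<^sup>2 - norm x * (2 * cmod z + norm x)"
    proof -
      have "0 \<le> (cmod z - 4 * norm x) * (cmod z + 2 * norm x)" using z by (intro mult_nonneg_nonneg) auto
      then have "norm x * (cmod z * 2) + norm x * (norm x * 8) \<le> cmod z * cmod z"
        by (simp add: algebra_simps)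
      moreover have "norm x * (norm x * 2) \<le> norm x * (norm x * 8)" by (intro mult_left_mono) auto
      ultimately have "norm x * (norm x * 2) + norm x * (cmod z * 2) \<le> cmod z * cmod z" by linarith
      then show ?thesis by (simp add: power2_eq_square algebra_simps)
    qed
    also have "\<dots> \<le> (cmod z)\<^sup>2 - norm x * norm (of_real (- 2 * Re z) + x)"
    proof -
      have "norm (of_real (- 2 * Re z) + x) \<le> \<bar>- 2 * Re z\<bar> + norm x"
        using norm_triangle_ineq[of "of_real (- 2 * Re z) :: 'k" x] by (simp only: norm_of_real)
      also have "\<dots> \<le> 2 * cmod z + norm x" using abs_Re_le_cmod[of z] by simp
      finally show ?thesis by (simp add: mult_left_mono)
    qed
    also have "\<dots> \<le> ?f z"
      unfolding fun_cong[OF f, of z] using norm_diff_ineq[of "of_real ((cmod z)\<^sup>2) :: 'k" "x * (of_real (- 2 * Re z) + x)"]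
      by (simp only: norm_mult norm_of_real abs_power2 real_norm_def)
    finally show ?thesis .
  qed (rule z0)
  define m where "m = ?f z0"
  have "m = 0"
  proof (rule ccontr)
    assume "m \<noteq> 0"
    then have m: "0 < m" by (simp add: m_def)
    have ge: "m \<le> ?f z" for z using min by (simp add: m_def)
    let ?g = "\<lambda>j::nat. quad z0 - [:real j * (m / 2):]"
    have g: "degree (?g j) = 2" "lead_coeff (?g j) = 1" for j by (simp_all add: quad_def)
    have real_poly_eval_g: "real_poly_eval x (?g j) = real_poly_eval x (quad z0) - of_real (real j * (m / 2))" for j
      by (simp add: quad_def)
    \<comment> \<open>The shift lemma with c = m/2 gives the upper bound; the lower bound holds
      because \<open>?g j\<close> is still monic of degree 2.\<close>
    have "norm (real_poly_eval x (?g j)) = m" for j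
    proof (induction j)
      case 0
      then show ?case by (simp add: m_def)
    next
      case (Suc j)
      have "norm (real_poly_eval x (?g j) - of_real (m / 2)) \<le> m"
        by (rule norm_shift_le[OF m ge g(2) g(1) Suc.IH]) (use m in auto)
      moreover have "real_poly_eval x (?g j) - of_real (m / 2) = real_poly_eval x (?g (Suc j))"
        unfolding real_poly_eval_g by (simp add: algebra_simps add_divide_distrib)
      moreover have "m\<^sup>2 \<le> (norm (real_poly_eval x (?g (Suc j))))\<^sup>2"
        using norm_ev_ge[OF m ge g(2)] by (simp only: g(1))
      then have "m \<le> norm (real_poly_eval x (?g (Suc j)))" by (rule power2_le_imp_le) simp
      ultimately show ?case by simp
    qed
    \<comment> \<open>Two elements of norm \<open>m\<close> are at most 2m apart, but five shifts
      move the value by 5m/2.\<close>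
    from this[of 5] have "norm (real_poly_eval x (quad z0) - of_real (5 * (m / 2))) = m"
      unfolding real_poly_eval_g by simp
    moreover have "norm (of_real (5 * (m / 2)) :: 'k) = 5 * (m / 2)" using m by (subst norm_of_real) simp
    ultimately show False
      using norm_triangle_ineq3[of "real_poly_eval x (quad z0)" "of_real (5 * (m / 2))"] m by (simp add: m_def[symmetric])
  qed
  then show ?thesis using that by (simp add: m_def)
qed

text \<open>A weak form of the Gelfand--Mazur theorem: the field is at most two-dimensional over the reals.\<close>

lemma compact_cball_real_normed_field:
  "compact (cball (0 :: 'k::real_normed_field) R)"
proof -
  have rep: "(\<exists>a. x = of_real a) \<or> (\<exists>a b j. j * j = -1 \<and> x = of_real a + of_real b * j)" for x :: 'k
  proof -
    obtain z where z: "real_poly_eval x (quad z) = 0" by (rule real_normed_field_quadratic)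
    then have e: "(x - of_real (Re z)) * (x - of_real (Re z)) = - of_real (Im z * Im z)"
      by (simp add: quad_def power2_eq_square algebra_simps add_eq_0_iff2)
    show ?thesis
    proof (cases "Im z = 0")
      case True
      then show ?thesis using e by auto
    next
      case False
      let ?j = "(x - of_real (Re z)) / of_real (Im z)"
      have "?j * ?j = -1" using e False by (simp add: divide_simps)
      moreover have "x = of_real (Re z) + of_real (Im z) * ?j" using False by simp
      ultimately show ?thesis by blast
    qed
  qed
  show ?thesis
  proof (cases "\<exists>i :: 'k. i * i = -1")
    case False
    have "cball (0 :: 'k) R \<subseteq> of_real ` {-R..R}"
    proof
      fix x :: 'k assume x: "x \<in> cball 0 R"
      obtain a where "x = of_real a" using rep[of x] False by blast
      then show "x \<in> of_real ` {-R..R}" using x by (auto simp: abs_le_iff)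
    qed
    moreover have "compact (of_real ` {-R..R} :: 'k set)"
      by (intro compact_continuous_image continuous_intros) auto
    ultimately show ?thesis
      by (metis closed_cball compact_Int_closed inf.absorb_iff2)
  next
    case True
    then obtain i :: 'k where i: "i * i = -1" by blast
    then have "norm i * norm i = 1" by (metis norm_minus_cancel norm_mult norm_one)
    then have "norm i = 1 \<or> norm i = -1" by (simp only: square_eq_1_iff)
    moreover have "norm i \<noteq> -1" using norm_ge_zero[of i] by linarith
    ultimately have ni: "norm i = 1" by blast
    let ?h = "\<lambda>(a, b). of_real a + of_real b * i"
    have "x \<in> ?h ` ({-2*R..2*R} \<times> {-2*R..2*R})" if x: "x \<in> cball 0 R" for x
    proof -
      have "\<exists>a b. x = of_real a + of_real b * i"
      proof -
        consider a where "x = of_real a" | a b j where "j * j = -1" "x = of_real a + of_real b * j"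
          using rep by blast
        then show ?thesis
        proof cases
          case 1
          then show ?thesis by (intro exI[of _ a] exI[of _ 0]) simp
        next
          case 2
          \<comment> \<open>A field has at most two square roots of -1, so one fixed
            \<open>i\<close> serves every element.\<close>
          have "(j - i) * (j + i) = 0" using 2 i by (simp add: algebra_simps)
          then consider "j = i" | "j = - i" by (auto simp: eq_neg_iff_add_eq_0)
          then show ?thesis
          proof cases
            case 1
            then show ?thesis using 2 by blast
          next
            case neg: 2
            then show ?thesis using 2 by (intro exI[of _ a] exI[of _ "- b"]) simp
          qed
        qed
      qed
      then obtain a b where ab: "x = of_real a + of_real b * i" by blast
      \<comment> \<open>The product with the conjugate has norm a^2 + b^2, while the conjugate has
        norm at most |a| + |b|; this bounds |a| + |b| by twice the norm of \<open>x\<close>.\<close>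
      let ?y = "of_real a - of_real b * i"
      have "x * ?y = of_real (a\<^sup>2 + b\<^sup>2)"
      proof -
        have "x * ?y = of_real (a * a) - of_real (b * b) * (i * i)" by (simp add: ab algebra_simps)
        then show ?thesis by (simp add: i power2_eq_square)
      qed
      then have "norm x * norm ?y = a\<^sup>2 + b\<^sup>2" by (metis abs_of_nonneg norm_mult norm_of_real sum_power2_ge_zero)
      moreover have "norm ?y \<le> \<bar>a\<bar> + \<bar>b\<bar>"
        using norm_triangle_ineq4[of "of_real a :: 'k" "of_real b * i"] by (simp add: norm_mult ni)
      ultimately have "a\<^sup>2 + b\<^sup>2 \<le> norm x * (\<bar>a\<bar> + \<bar>b\<bar>)" by (metis mult_left_mono norm_ge_zero)
      then have le: "(\<bar>a\<bar> + \<bar>b\<bar>)\<^sup>2 \<le> 2 * norm x * (\<bar>a\<bar> + \<bar>b\<bar>)"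
        using zero_le_power2[of "\<bar>a\<bar> - \<bar>b\<bar>"] by (simp add: power2_eq_square algebra_simps)
      have "\<bar>a\<bar> + \<bar>b\<bar> \<le> 2 * norm x"
      proof (cases "\<bar>a\<bar> + \<bar>b\<bar> = 0")
        case True
        then show ?thesis using norm_ge_zero[of x] by linarith
      next
        case False
        then have "0 < \<bar>a\<bar> + \<bar>b\<bar>" by linarith
        then show ?thesis using le unfolding power2_eq_square by (simp only: mult_le_cancel_right_pos)
      qed
      then have "\<bar>a\<bar> \<le> 2 * R" "\<bar>b\<bar> \<le> 2 * R" using x by auto
      then show ?thesis using ab by (intro image_eqI[of _ _ "(a, b)"]) auto
    qed
    then have "cball 0 R \<subseteq> ?h ` ({-2*R..2*R} \<times> {-2*R..2*R})" by blast
    moreover have "compact (?h ` ({-2*R..2*R} \<times> {-2*R..2*R}))"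
      by (intro compact_continuous_image compact_Times) (auto simp: case_prod_unfold intro!: continuous_intros)
    ultimately show ?thesis
      by (metis closed_cball compact_Int_closed inf.absorb_iff2)
  qed
qed

subsection \<open>Finite-dimensional sections of the subspace\<close>

lemma compact_set_sum:
  fixes C :: "'i \<Rightarrow> 'a::real_normed_vector set"
  assumes "finite I" "\<And>i. i \<in> I \<Longrightarrow> compact (C i)"
  shows "compact {\<Sum>i\<in>I. v i | v. \<forall>i\<in>I. v i \<in> C i}"
  using assms
proof (induction I)
  case (insert j I)
  let ?S = "{\<Sum>i\<in>I. v i | v. \<forall>i\<in>I. v i \<in> C i}"
  have "{\<Sum>i\<in>insert j I. v i | v. \<forall>i\<in>insert j I. v i \<in> C i} = {x + y | x y. x \<in> C j \<and> y \<in> ?S}" (is "?L = ?R")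
  proof
    show "?L \<subseteq> ?R" using insert.hyps by auto
    show "?R \<subseteq> ?L"
    proof
      fix w assume "w \<in> ?R"
      then obtain x v where x: "x \<in> C j" and v: "\<forall>i\<in>I. v i \<in> C i" and w: "w = x + (\<Sum>i\<in>I. v i)" by blast
      have "(\<Sum>i\<in>I. (v(j := x)) i) = (\<Sum>i\<in>I. v i)"
        using insert.hyps by (intro sum.cong) auto
      then have "w = (\<Sum>i\<in>insert j I. (v(j := x)) i)" using w insert.hyps by simp
      moreover have "\<forall>i\<in>insert j I. (v(j := x)) i \<in> C i" using x v by auto
      ultimately show "w \<in> ?L" by blast
    qed
  qed
  moreover have "compact ?R" using insert by (intro compact_sums) auto
  ultimately show ?case by simp
qed simp

text \<open>Divide by a coefficient of largest modulus. The combinations whose j-th coefficient is 1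
  and whose others lie in [-1, 1] form a compact set avoiding 0, so they stay at a positive distance
  from it; take the least distance over all \<open>j\<close>.\<close>

lemma independent_lower_bound:
  fixes b :: "nat \<Rightarrow> 'a::real_normed_vector"
  assumes indep: "\<And>\<xi>. (\<Sum>i<n. \<xi> i *\<^sub>R b i) = 0 \<Longrightarrow> \<forall>i<n. \<xi> i = 0"
  shows "\<exists>\<kappa>>0. \<forall>\<xi>. \<forall>i<n. \<kappa> * \<bar>\<xi> i\<bar> \<le> norm (\<Sum>i<n. \<xi> i *\<^sub>R b i)"
proof -
  have "\<exists>d>0. \<forall>\<xi>. \<xi> j = 1 \<longrightarrow> (\<forall>i<n. \<bar>\<xi> i\<bar> \<le> 1) \<longrightarrow> d \<le> norm (\<Sum>i<n. \<xi> i *\<^sub>R b i)" if j: "j < n" for j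
  proof -
    define C where "C i = (if i = j then {b j} else (\<lambda>t. t *\<^sub>R b i) ` {-1..1})" for i
    define F where "F = {\<Sum>i<n. v i | v. \<forall>i\<in>{..<n}. v i \<in> C i}"
    have "compact (C i)" for i
      unfolding C_def by (auto intro!: compact_continuous_image continuous_intros)
    then have F: "compact F" unfolding F_def by (intro compact_set_sum) auto
    have F0: "0 \<notin> F"
    proof
      assume "0 \<in> F"
      then obtain v where v: "0 = (\<Sum>i<n. v i)" "\<forall>i\<in>{..<n}. v i \<in> C i" unfolding F_def by blast
      have "\<exists>t. v i = t *\<^sub>R b i \<and> (i = j \<longrightarrow> t = 1)" if "i < n" for i
      proof (cases "i = j")
        case True
        then have "v i = b j" using bspec[OF v(2), of i] that by (simp add: C_def)
        then show ?thesis using True by (intro exI[of _ 1]) simp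
      next
        case False
        then have "v i \<in> (\<lambda>t. t *\<^sub>R b i) ` {-1..1}" using bspec[OF v(2), of i] that by (simp add: C_def)
        then show ?thesis using False by blast
      qed
      then obtain t where t: "\<And>i. i < n \<Longrightarrow> v i = t i *\<^sub>R b i \<and> (i = j \<longrightarrow> t i = 1)" by metis
      then have "(\<Sum>i<n. t i *\<^sub>R b i) = 0" using v(1) by simp
      then show False using indep[of t] t j by auto
    qed
    have "\<exists>d>0. \<forall>x\<in>F. d \<le> norm x"
    proof (cases "F = {}")
      case True
      show ?thesis unfolding True by (intro exI[of _ 1]) simp
    next
      case False
      then have "\<exists>x\<in>F. \<forall>y\<in>F. norm x \<le> norm y"
        by (intro continuous_attains_inf F continuous_intros)
      then obtain x where x: "x \<in> F" "\<forall>y\<in>F. norm x \<le> norm y" by blast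
      then have "0 < norm x" using F0 by auto
      then show ?thesis using x(2) by blast
    qed
    then obtain d where d: "d > 0" "\<forall>x\<in>F. d \<le> norm x" by blast
    have "d \<le> norm (\<Sum>i<n. \<xi> i *\<^sub>R b i)" if "\<xi> j = 1" "\<forall>i<n. \<bar>\<xi> i\<bar> \<le> 1" for \<xi>
    proof -
      have "\<forall>i\<in>{..<n}. \<xi> i *\<^sub>R b i \<in> C i" using that by (auto simp: C_def abs_le_iff)
      then have "(\<Sum>i<n. \<xi> i *\<^sub>R b i) \<in> F" unfolding F_def by blast
      with d(2) show ?thesis by (rule bspec)
    qed
    then show ?thesis using d(1) by blast
  qed
  then obtain d where d: "\<And>j. j < n \<Longrightarrow> 0 < d j"
    and dle: "\<And>j \<xi>. j < n \<Longrightarrow> \<xi> j = 1 \<Longrightarrow> (\<forall>i<n. \<bar>\<xi> i\<bar> \<le> 1) \<Longrightarrow> d j \<le> norm (\<Sum>i<n. \<xi> i *\<^sub>R b i)"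
    by metis
  define \<kappa> where "\<kappa> = Min (insert 1 (d ` {..<n}))"
  have \<kappa>: "0 < \<kappa>" "\<And>j. j < n \<Longrightarrow> \<kappa> \<le> d j" using d by (auto simp: \<kappa>_def)
  have "\<kappa> * \<bar>\<xi> i\<bar> \<le> norm (\<Sum>i<n. \<xi> i *\<^sub>R b i)" if i: "i < n" for \<xi> i
  proof -
    have "Max ((\<lambda>i. \<bar>\<xi> i\<bar>) ` {..<n}) \<in> (\<lambda>i. \<bar>\<xi> i\<bar>) ` {..<n}" using i by (intro Max_in) auto
    then obtain j where j: "j < n" "Max ((\<lambda>i. \<bar>\<xi> i\<bar>) ` {..<n}) = \<bar>\<xi> j\<bar>" by auto
    have le: "\<bar>\<xi> l\<bar> \<le> \<bar>\<xi> j\<bar>" if "l < n" for l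
      unfolding j(2)[symmetric] using that by (intro Max_ge) auto
    show ?thesis
    proof (cases "\<xi> j = 0")
      case True
      then show ?thesis using le[OF i] by simp
    next
      case False
      have "d j \<le> norm (\<Sum>i<n. (\<xi> i / \<xi> j) *\<^sub>R b i)"
        using j False le by (intro dle) (auto simp: abs_divide)
      also have "(\<Sum>i<n. (\<xi> i / \<xi> j) *\<^sub>R b i) = (1 / \<xi> j) *\<^sub>R (\<Sum>i<n. \<xi> i *\<^sub>R b i)"
        by (simp add: scaleR_sum_right)
      finally have "d j * \<bar>\<xi> j\<bar> \<le> norm (\<Sum>i<n. \<xi> i *\<^sub>R b i)"
        using False by (simp add: pos_le_divide_eq)
      moreover have "\<kappa> * \<bar>\<xi> i\<bar> \<le> d j * \<bar>\<xi> j\<bar>"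
        using \<kappa>(1) \<kappa>(2)[OF j(1)] le[OF i] by (intro mult_mono) auto
      ultimately show ?thesis by linarith
    qed
  qed
  with \<kappa>(1) show ?thesis by blast
qed

text \<open>Among the balls of radius \<delta>/2 in a finite cover of \<open>S\<close>, one receives
  at least \<open>r\<close> of the points. The number \<open>K\<close> is chosen before
  \<open>f\<close>, which matters because the points will depend on an ellipsoid in dimension 2K and
  on an isometry.\<close>

lemma compact_pigeonhole:
  fixes S :: "'a::metric_space set"
  assumes "compact S" "0 < \<delta>"
  obtains K :: nat where "r < K" "\<And>f. (\<And>i. i < K \<Longrightarrow> f i \<in> S) \<Longrightarrow>
    \<exists>J\<subseteq>{..<K}. r \<le> card J \<and> (\<forall>i\<in>J. \<forall>j\<in>J. dist (f i) (f j) < \<delta>)"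
proof -
  obtain F where F: "finite F" "S \<subseteq> (\<Union>x\<in>F. ball x (\<delta>/2))"
    using assms compact_eq_totally_bounded[of S] by (meson half_gt_zero)
  define K where "K = r * card F + r + 1"
  have "\<exists>J\<subseteq>{..<K}. r \<le> card J \<and> (\<forall>i\<in>J. \<forall>j\<in>J. dist (f i) (f j) < \<delta>)"
    if f: "\<And>i. i < K \<Longrightarrow> f i \<in> S" for f
  proof -
    have "\<forall>i\<in>{..<K}. \<exists>x\<in>F. dist x (f i) < \<delta>/2"
      using F(2) f by (fastforce simp: subset_iff)
    then obtain c where c: "\<And>i. i < K \<Longrightarrow> c i \<in> F" "\<And>i. i < K \<Longrightarrow> dist (c i) (f i) < \<delta>/2"
      by (metis lessThan_iff)
    have "F \<noteq> {}" using c(1)[of 0] by (auto simp: K_def)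
    then obtain y where y: "card {..<K} \<le> card (c -` {y} \<inter> {..<K}) * card F"
      using pigeonhole_card[of c "{..<K}" F] c(1) F(1) by auto
    let ?J = "c -` {y} \<inter> {..<K}"
    have "r \<le> card ?J"
    proof (rule ccontr)
      assume "\<not> r \<le> card ?J"
      then have "card ?J * card F \<le> r * card F" by (intro mult_right_mono) auto
      then have "K \<le> r * card F" using y by (metis card_lessThan order_trans)
      then show False by (simp add: K_def)
    qed
    moreover have "dist (f i) (f j) < \<delta>" if "i \<in> ?J" "j \<in> ?J" for i j
      using that c(2)[of i] c(2)[of j] dist_triangle_half_r[of y "f i" \<delta> "f j"] by simp
    ultimately show ?thesis by (intro exI[of _ ?J]) auto
  qed
  then show ?thesis using that[of K] by (simp add: K_def)
qed

section \<open>The subspace with its equivalent norm, and its real finite-dimensional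
  sections\<close>

locale normed_subspace = banach_space_over smul
  for smul :: "'k::{real_normed_field,banach} \<Rightarrow> 'a::banach \<Rightarrow> 'a" +
  fixes Y :: "'a set" and N :: "'a \<Rightarrow> real"
  assumes Y: "closed_infdim_subspace smul Y" and N: "equivalent_norm_on smul Y N"
begin

lemma subspace_Y: "subspace Y" and infdim_Y: "finite B \<Longrightarrow> span B \<noteq> Y"
  using Y by (auto simp: closed_infdim_subspace_def)

lemma Y_0 [simp, intro]: "0 \<in> Y"
  and Y_add [simp, intro]: "x \<in> Y \<Longrightarrow> y \<in> Y \<Longrightarrow> x + y \<in> Y"
  and Y_diff [simp, intro]: "x \<in> Y \<Longrightarrow> y \<in> Y \<Longrightarrow> x - y \<in> Y"
  and Y_scaleR [simp, intro]: "x \<in> Y \<Longrightarrow> r *\<^sub>R x \<in> Y"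
  using subspace_0[OF subspace_Y] subspace_add[OF subspace_Y] subspace_diff[OF subspace_Y]
    subspace_scale[OF subspace_Y, of x "of_real r"]
  by (auto simp: scale_of_real)

lemma Y_sum [intro]: "(\<And>i. i \<in> I \<Longrightarrow> f i \<in> Y) \<Longrightarrow> sum f I \<in> Y"
  by (rule subspace_sum[OF subspace_Y])

lemma N_nonneg [simp]: "x \<in> Y \<Longrightarrow> 0 \<le> N x"
  and N_eq_0: "x \<in> Y \<Longrightarrow> N x = 0 \<longleftrightarrow> x = 0"
  and N_add: "x \<in> Y \<Longrightarrow> y \<in> Y \<Longrightarrow> N (x + y) \<le> N x + N y"
  using N by (auto simp: equivalent_norm_on_def norm_on_def)

lemma N_scaleR: "x \<in> Y \<Longrightarrow> N (r *\<^sub>R x) = \<bar>r\<bar> * N x"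
  using N scale_of_real[of r x] unfolding equivalent_norm_on_def norm_on_def
  by (metis norm_of_real)

lemma N_minus: "x \<in> Y \<Longrightarrow> y \<in> Y \<Longrightarrow> N (x - y) = N (y - x)"
  using N_scaleR[of "x - y" "-1"] by simp

lemma N_diff: "x \<in> Y \<Longrightarrow> y \<in> Y \<Longrightarrow> N (x - y) \<le> N x + N y"
  using N_add[of x "(-1) *\<^sub>R y"] N_scaleR[of y "-1"] Y_scaleR[of y "-1"] by simp

lemma N_triangle: "x \<in> Y \<Longrightarrow> y \<in> Y \<Longrightarrow> N x \<le> N y + N (x - y)"
  using N_add[of y "x - y"] by simp

lemma N_sum: "finite I \<Longrightarrow> (\<And>i. i \<in> I \<Longrightarrow> f i \<in> Y) \<Longrightarrow> N (sum f I) \<le> (\<Sum>i\<in>I. N (f i))"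
proof (induction I rule: finite_induct)
  case empty
  then show ?case using N_eq_0[of 0] by simp
next
  case (insert i I)
  then show ?case using N_add[of "f i" "sum f I"] Y_sum[of I f] by auto
qed

text \<open>Each new vector is taken outside the span over the full scalar field, which contains the
  real span; the independence obtained is the real one, as real ellipsoids require.\<close>

lemma independent_family:
  "\<exists>b. (\<forall>i<n. b i \<in> Y) \<and> (\<forall>\<xi>. (\<Sum>i<n. \<xi> i *\<^sub>R b i) = 0 \<longrightarrow> (\<forall>i<n. \<xi> i = 0))" for n :: nat
proof (induction n)
  case (Suc n)
  then obtain b where b: "\<And>i. i < n \<Longrightarrow> b i \<in> Y"
    and indep: "\<And>\<xi>. (\<Sum>i<n. \<xi> i *\<^sub>R b i) = 0 \<Longrightarrow> \<forall>i<n. \<xi> i = 0" by blast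
  have "span (b ` {..<n}) \<subseteq> Y" using b by (intro span_minimal subspace_Y) auto
  then obtain c where c: "c \<in> Y" "c \<notin> span (b ` {..<n})"
    using infdim_Y[of "b ` {..<n}"] by auto
  have "\<forall>i<Suc n. \<xi> i = 0" if s: "(\<Sum>i<Suc n. \<xi> i *\<^sub>R (b(n := c)) i) = 0" for \<xi>
  proof -
    have s': "(\<Sum>i<n. \<xi> i *\<^sub>R b i) + \<xi> n *\<^sub>R c = 0" using s by simp
    have "\<xi> n = 0"
    proof (rule ccontr)
      assume "\<xi> n \<noteq> 0"
      have c_eq: "\<xi> n *\<^sub>R c = - (\<Sum>i<n. \<xi> i *\<^sub>R b i)"
        using s' by (simp only: add_eq_0_iff)
      have "c = (1 / \<xi> n) *\<^sub>R (\<xi> n *\<^sub>R c)" using \<open>\<xi> n \<noteq> 0\<close> by simp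
      also have "\<dots> = (1 / \<xi> n) *\<^sub>R (- (\<Sum>i<n. \<xi> i *\<^sub>R b i))" by (simp only: c_eq)
      also have "\<dots> = smul (of_real (1 / \<xi> n)) (- (\<Sum>i<n. smul (of_real (\<xi> i)) (b i)))"
        by (simp only: scale_of_real)
      also have "\<dots> \<in> span (b ` {..<n})"
        by (intro span_scale span_neg span_sum span_base) auto
      finally show False using c(2) by simp
    qed
    then show ?thesis using s' indep[of \<xi>] by (auto simp: less_Suc_eq)
  qed
  then show ?case using b c(1) by (intro exI[of _ "b(n := c)"]) (auto simp: less_Suc_eq)
qed simp

lemma coordinate_norm:
  assumes "0 < (k :: nat)"
  obtains b \<kappa> U where "\<And>i. i < 2 * k \<Longrightarrow> b i \<in> Y"
    "fin_dim_norm (2 * k) k (\<lambda>\<xi>. N (\<Sum>i<2*k. \<xi> i *\<^sub>R b i)) \<kappa> U"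
proof -
  obtain b where b: "\<And>i. i < 2 * k \<Longrightarrow> b i \<in> Y"
    and indep: "\<And>\<xi>. (\<Sum>i<2*k. \<xi> i *\<^sub>R b i) = 0 \<Longrightarrow> \<forall>i<2*k. \<xi> i = 0"
    using independent_family[of "2*k"] by blast
  obtain \<kappa> where \<kappa>: "0 < \<kappa>" "\<And>\<xi> i. i < 2*k \<Longrightarrow> \<kappa> * \<bar>\<xi> i\<bar> \<le> norm (\<Sum>i<2*k. \<xi> i *\<^sub>R b i)"
    using independent_lower_bound[where n = "2*k" and b = b, OF indep] by blast
  obtain a where a: "0 < a" "\<And>y. y \<in> Y \<Longrightarrow> a * norm y \<le> N y"
    using N unfolding equivalent_norm_on_def by blast
  define U where "U = (\<Sum>i<2*k. N (b i)) + 1"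
  have L: "(\<Sum>i<2*k. \<xi> i *\<^sub>R b i) \<in> Y" for \<xi> using b by (intro Y_sum Y_scaleR) auto
  have U: "0 < U" "\<And>i. i < 2*k \<Longrightarrow> N (b i) \<le> U"
  proof -
    show "0 < U" unfolding U_def using b by (intro add_nonneg_pos sum_nonneg) auto
    fix i assume "i < 2*k"
    then have "N (b i) \<le> (\<Sum>i<2*k. N (b i))" using b by (intro member_le_sum) auto
    then show "N (b i) \<le> U" by (simp add: U_def)
  qed
  have "fin_dim_norm (2 * k) k (\<lambda>\<xi>. N (\<Sum>i<2*k. \<xi> i *\<^sub>R b i)) (a * \<kappa>) U"
  proof
    show "2 * k = 2 * k" "0 < k" "0 < a * \<kappa>" "0 < U" using assms a \<kappa> U by auto
    fix x y :: "nat \<Rightarrow> real"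
    show "N (\<Sum>i<2*k. (x i + y i) *\<^sub>R b i) \<le> N (\<Sum>i<2*k. x i *\<^sub>R b i) + N (\<Sum>i<2*k. y i *\<^sub>R b i)"
      using N_add[OF L[of x] L[of y]] by (simp add: scaleR_add_left sum.distrib)
    show "N (\<Sum>i<2*k. x i *\<^sub>R b i) = N (\<Sum>i<2*k. y i *\<^sub>R b i)" if "\<And>i. i < 2*k \<Longrightarrow> x i = y i"
      using that by simp
    show "N (\<Sum>i<2*k. (c * x i) *\<^sub>R b i) = \<bar>c\<bar> * N (\<Sum>i<2*k. x i *\<^sub>R b i)" for c
      using N_scaleR[OF L[of x], of c] by (simp add: scaleR_sum_right)
    show "(a * \<kappa>) * \<bar>x i\<bar> \<le> N (\<Sum>i<2*k. x i *\<^sub>R b i)" if "i < 2*k" for i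
      using order_trans[OF mult_left_mono[OF \<kappa>(2)[OF that, of x], of a] a(2)[OF L[of x]]] a(1)
      by (simp add: mult.assoc)
    have "N (\<Sum>i<2*k. x i *\<^sub>R b i) \<le> (\<Sum>i<2*k. N (x i *\<^sub>R b i))" using b by (intro N_sum) auto
    also have "\<dots> \<le> (\<Sum>i<2*k. \<bar>x i\<bar> * U)"
      using b U by (intro sum_mono) (auto simp: N_scaleR intro!: mult_left_mono)
    finally show "N (\<Sum>i<2*k. x i *\<^sub>R b i) \<le> U * (\<Sum>i<2*k. \<bar>x i\<bar>)"
      by (simp add: sum_distrib_left mult.commute)
  qed
  with b show ?thesis using that by blast
qed

lemma Dvoretzky_Rogers_lower:
  assumes "0 < (k :: nat)" and \<eta>: "0 < \<eta>" "\<eta> < 1"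
  obtains x z g where "x \<in> Y" "N x = 1" "\<And>i. i < k \<Longrightarrow> z i \<in> Y" "\<And>i. i < k \<Longrightarrow> N (z i) = 1"
    "\<And>i. i < k \<Longrightarrow> \<bar>g i\<bar> \<le> (1::real)"
    "\<And>i j. i < k \<Longrightarrow> j < k \<Longrightarrow> i \<noteq> j \<Longrightarrow> 1/4 \<le> N (z i - z j)"
    "\<And>i j t. i < k \<Longrightarrow> j < k \<Longrightarrow> i \<noteq> j \<Longrightarrow>
      1 - \<eta> + 2 * t * (g i - g j) + t\<^sup>2 / 16 \<le> (N (x + t *\<^sub>R (z i - z j)))\<^sup>2"
proof -
  obtain b \<kappa> U where b: "\<And>i. i < 2 * k \<Longrightarrow> b i \<in> Y"
    and fd: "fin_dim_norm (2 * k) k (\<lambda>\<xi>. N (\<Sum>i<2*k. \<xi> i *\<^sub>R b i)) \<kappa> U"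
    using coordinate_norm[OF assms(1)] by blast
  define L where "L \<xi> = (\<Sum>i<2*k. \<xi> i *\<^sub>R b i)" for \<xi>
  have LY: "L \<xi> \<in> Y" for \<xi> unfolding L_def using b by (intro Y_sum Y_scaleR) auto
  have Ld: "L (\<lambda>l. x l - y l) = L x - L y" for x y
    by (simp add: L_def scaleR_diff_left sum_subtractf)
  have Lc: "L (\<lambda>l. x l + t * (y l - z l)) = L x + t *\<^sub>R (L y - L z)" for x y z t
    by (simp add: L_def algebra_simps sum.distrib sum_subtractf scaleR_sum_right)
  show ?thesis
  proof (rule fin_dim_norm.Dvoretzky_Rogers_circumscribed[OF fd \<eta>, folded L_def])
    fix x z and g :: "nat \<Rightarrow> real"
    assume "N (L x) = 1" "\<And>i. i < k \<Longrightarrow> N (L (z i)) = 1" "\<And>i. i < k \<Longrightarrow> \<bar>g i\<bar> \<le> 1"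
      "\<And>i j. i < k \<Longrightarrow> j < k \<Longrightarrow> i \<noteq> j \<Longrightarrow> 1/4 \<le> N (L (\<lambda>l. z i l - z j l))"
      "\<And>i j t. i < k \<Longrightarrow> j < k \<Longrightarrow> i \<noteq> j \<Longrightarrow>
        1 - \<eta> + 2 * t * (g i - g j) + t\<^sup>2 / 16 \<le> (N (L (\<lambda>l. x l + t * (z i l - z j l))))\<^sup>2"
    from this[unfolded Ld Lc] show ?thesis
      by (intro that[of "L x" "\<lambda>i. L (z i)" g] LY)
  qed
qed

lemma Dvoretzky_Rogers_upper:
  assumes "0 < (k :: nat)" and \<eta>: "0 < \<eta>" "\<eta> < 1"
  obtains x z g where "x \<in> Y" "N x = 1" "\<And>i. i < k \<Longrightarrow> z i \<in> Y"
    "\<And>i. i < k \<Longrightarrow> 1/4 \<le> N (z i)" "\<And>i. i < k \<Longrightarrow> N (z i) \<le> 1"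
    "\<And>i. i < k \<Longrightarrow> \<bar>g i\<bar> \<le> (1::real)"
    "\<And>S. S \<subseteq> {..<k} \<Longrightarrow> (N (\<Sum>i\<in>S. z i))\<^sup>2 \<le> card S"
    "\<And>i j t. i < k \<Longrightarrow> j < k \<Longrightarrow> i \<noteq> j \<Longrightarrow>
      (N (x + t *\<^sub>R (z i - z j)))\<^sup>2 \<le> (1 + 2 * \<bar>t\<bar> * \<bar>g i - g j\<bar> + 2 * t\<^sup>2) / (1 - \<eta>)"
proof -
  obtain b \<kappa> U where b: "\<And>i. i < 2 * k \<Longrightarrow> b i \<in> Y"
    and fd: "fin_dim_norm (2 * k) k (\<lambda>\<xi>. N (\<Sum>i<2*k. \<xi> i *\<^sub>R b i)) \<kappa> U"
    using coordinate_norm[OF assms(1)] by blast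
  define L where "L \<xi> = (\<Sum>i<2*k. \<xi> i *\<^sub>R b i)" for \<xi>
  have LY: "L \<xi> \<in> Y" for \<xi> unfolding L_def using b by (intro Y_sum Y_scaleR) auto
  have Lc: "L (\<lambda>l. x l + t * (y l - z l)) = L x + t *\<^sub>R (L y - L z)" for x y z t
    by (simp add: L_def algebra_simps sum.distrib sum_subtractf scaleR_sum_right)
  have Ls: "L (\<lambda>l. \<Sum>i\<in>S. z i l) = (\<Sum>i\<in>S. L (z i))" for S :: "nat set" and z
    unfolding L_def scaleR_sum_left by (rule sum.swap)
  show ?thesis
  proof (rule fin_dim_norm.Dvoretzky_Rogers_inscribed[OF fd \<eta>, folded L_def])
    fix x z and g :: "nat \<Rightarrow> real"
    assume "N (L x) = 1" "\<And>i. i < k \<Longrightarrow> 1/4 \<le> N (L (z i))" "\<And>i. i < k \<Longrightarrow> N (L (z i)) \<le> 1"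
      "\<And>i. i < k \<Longrightarrow> \<bar>g i\<bar> \<le> 1"
      "\<And>S. S \<subseteq> {..<k} \<Longrightarrow> (N (L (\<lambda>l. \<Sum>i\<in>S. z i l)))\<^sup>2 \<le> card S"
      "\<And>i j t. i < k \<Longrightarrow> j < k \<Longrightarrow> i \<noteq> j \<Longrightarrow>
        (N (L (\<lambda>l. x l + t * (z i l - z j l))))\<^sup>2 \<le> (1 + 2 * \<bar>t\<bar> * \<bar>g i - g j\<bar> + 2 * t\<^sup>2) / (1 - \<eta>)"
    from this[unfolded Ls Lc] show ?thesis
      by (intro that[of "L x" "\<lambda>i. L (z i)" g] LY)
  qed
qed

end

subsection \<open>Almost transitive norms\<close>

locale transitive_subspace = normed_subspace +
  assumes transitive: "almost_transitive smul Y N"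
begin

lemma near_isometry:
  assumes "x \<in> Y" "N x = 1" "u \<in> Y" "N u = 1" "0 < \<epsilon>"
  obtains T where "\<And>y. y \<in> Y \<Longrightarrow> T y \<in> Y" "\<And>y. y \<in> Y \<Longrightarrow> N (T y) = N y"
    "\<And>y z. y \<in> Y \<Longrightarrow> z \<in> Y \<Longrightarrow> T (y + z) = T y + T z"
    "\<And>y z. y \<in> Y \<Longrightarrow> z \<in> Y \<Longrightarrow> T (y - z) = T y - T z"
    "\<And>y r. y \<in> Y \<Longrightarrow> T (r *\<^sub>R y) = r *\<^sub>R T y"
    "N (T x - u) < \<epsilon>"
proof -
  obtain T where T: "T \<in> surj_linear_isometries smul Y N" "N (T x - u) < \<epsilon>"
    using transitive assms unfolding almost_transitive_def by blast
  have TY: "T y \<in> Y" if "y \<in> Y" for y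
    using T(1) that unfolding surj_linear_isometries_def by blast
  have add: "T (y + z) = T y + T z" if "y \<in> Y" "z \<in> Y" for y z
    using T(1) that unfolding surj_linear_isometries_def by blast
  have "T (smul (of_real r) y) = smul (of_real r) (T y)" if "y \<in> Y" for y r
    using T(1) that unfolding surj_linear_isometries_def by blast
  then have sc: "T (r *\<^sub>R y) = r *\<^sub>R T y" if "y \<in> Y" for y r
    using that by (simp add: scale_of_real)
  have diff: "T (y - z) = T y - T z" if "y \<in> Y" "z \<in> Y" for y z
    using add[of "y - z" z] that by simp
  show ?thesis
    using T unfolding surj_linear_isometries_def by (intro that[OF TY _ add diff sc]) auto
qed

lemma unit_vector:
  obtains u where "u \<in> Y" "N u = 1"
  by (rule Dvoretzky_Rogers_lower[of 1 "1/2"]) (use that in auto)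

section \<open>Increments that are small under a map \<open>P\<close> taking the unit ball of
  \<open>Y\<close> into a compact set\<close>

context
  fixes P :: "'b \<Rightarrow> 'b" and S :: "'b set"
  assumes P_diff: "\<And>x y. x \<in> Y \<Longrightarrow> y \<in> Y \<Longrightarrow> P (x - y) = P x - P y"
    and S: "compact S" "\<And>x. x \<in> Y \<Longrightarrow> N x \<le> 1 \<Longrightarrow> P x \<in> S"
begin

text \<open>The quadratic gain t^2/16 is four times t^2/64. Imperfect contact, the linear term in
  \<open>g i - g j\<close> and the error of the isometry each use up one such share, and the fourth
  remains.\<close>

lemma unit_step_lower:
  assumes u: "u \<in> Y" "N u = 1" and t: "0 < t" and \<delta>: "0 < \<delta>"
  obtains y where "y \<in> Y" "1/8 \<le> N y" "N y \<le> 2" "norm (P y) \<le> \<delta>"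
    "1 + t\<^sup>2 / 64 \<le> (N (u + t *\<^sub>R y))\<^sup>2"
proof -
  define d where "d = min \<delta> (t / 128)"
  have d: "0 < d" "d \<le> \<delta>" "d \<le> t / 128" using \<delta> t by (auto simp: d_def)
  obtain K :: nat where K: "2 < K" and pig: "\<And>f. (\<And>i. i < K \<Longrightarrow> f i \<in> S \<times> {-1..1::real}) \<Longrightarrow>
    \<exists>J\<subseteq>{..<K}. 2 \<le> card J \<and> (\<forall>i\<in>J. \<forall>j\<in>J. dist (f i) (f j) < d)"
    using compact_pigeonhole[OF compact_Times[OF S(1) compact_Icc] d(1)] by blast
  define \<eta> where "\<eta> = min (1/2) (t\<^sup>2 / 64)"
  have \<eta>: "0 < \<eta>" "\<eta> < 1" "\<eta> \<le> t\<^sup>2 / 64" using t by (auto simp: \<eta>_def)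
  have "0 < K" using K by simp
  from Dvoretzky_Rogers_lower[OF this \<eta>(1,2)]
  obtain x z g where x: "x \<in> Y" "N x = 1" and z: "\<And>i. i < K \<Longrightarrow> z i \<in> Y" "\<And>i. i < K \<Longrightarrow> N (z i) = 1"
    and g: "\<And>i. i < K \<Longrightarrow> \<bar>g i\<bar> \<le> (1::real)"
    and sep: "\<And>i j. i < K \<Longrightarrow> j < K \<Longrightarrow> i \<noteq> j \<Longrightarrow> 1/4 \<le> N (z i - z j)"
    and low: "\<And>i j t. i < K \<Longrightarrow> j < K \<Longrightarrow> i \<noteq> j \<Longrightarrow>
      1 - \<eta> + 2 * t * (g i - g j) + t\<^sup>2 / 16 \<le> (N (x + t *\<^sub>R (z i - z j)))\<^sup>2" by blast
  \<comment> \<open>Replacing \<open>T x\<close> by \<open>u\<close> lowers the square by at most 2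
    \<epsilon> times a norm that is at most 1 + 2t, that is, by at most t^2/64.\<close>
  define \<epsilon> where "\<epsilon> = t\<^sup>2 / (128 * (1 + 2 * t))"
  have \<epsilon>: "0 < \<epsilon>" using t by (simp add: \<epsilon>_def)
  obtain T where TY: "\<And>y. y \<in> Y \<Longrightarrow> T y \<in> Y" and TN: "\<And>y. y \<in> Y \<Longrightarrow> N (T y) = N y"
    and Tadd: "\<And>y z. y \<in> Y \<Longrightarrow> z \<in> Y \<Longrightarrow> T (y + z) = T y + T z"
    and Tdiff: "\<And>y z. y \<in> Y \<Longrightarrow> z \<in> Y \<Longrightarrow> T (y - z) = T y - T z"
    and Tsc: "\<And>y r. y \<in> Y \<Longrightarrow> T (r *\<^sub>R y) = r *\<^sub>R T y"
    and Tx: "N (T x - u) < \<epsilon>"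
    by (rule near_isometry[OF x u \<epsilon>]) blast
  \<comment> \<open>The records combine the \<open>P\<close>-image of the moved vector with the
    inner product, so closeness of two records controls both at once.\<close>
  have "(P (T (z i)), g i) \<in> S \<times> {-1..1}" if "i < K" for i
    using S(2)[of "T (z i)"] TY TN z[OF that] g[OF that] by (auto simp: abs_le_iff)
  then obtain J where J: "J \<subseteq> {..<K}" "2 \<le> card J"
    "\<And>i j. i \<in> J \<Longrightarrow> j \<in> J \<Longrightarrow> dist (P (T (z i)), g i) (P (T (z j)), g j) < d"
    using pig[of "\<lambda>i. (P (T (z i)), g i)"] by blast
  have "\<exists>i\<in>J. \<exists>j\<in>J. i \<noteq> j"
  proof (rule ccontr)
    assume "\<not> ?thesis"
    then have "card J \<le> Suc 0" using card_le_Suc0_iff_eq[of J] finite_subset[OF J(1)] by blast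
    then show False using J(2) by simp
  qed
  then obtain i j where ij: "i \<in> J" "j \<in> J" "i \<noteq> j" by blast
  then have K: "i < K" "j < K" using J(1) by auto
  define w where "w = z i - z j"
  have w: "w \<in> Y" "1/4 \<le> N w" "N w \<le> 2"
    using z[OF K(1)] z[OF K(2)] sep[OF K ij(3)] N_diff[of "z i" "z j"] by (auto simp: w_def)
  have close: "norm (P (T (z i)) - P (T (z j))) < d" "\<bar>g i - g j\<bar> < d"
    using J(3)[OF ij(1,2)] dist_fst_le[of "(P (T (z i)), g i)" "(P (T (z j)), g j)"]
      dist_snd_le[of "(P (T (z i)), g i)" "(P (T (z j)), g j)"]
    by (auto simp: dist_norm)
  show ?thesis
  proof (rule that[of "T w"])
    show "T w \<in> Y" "1/8 \<le> N (T w)" "N (T w) \<le> 2" using w TY TN by auto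
    show "norm (P (T w)) \<le> \<delta>"
      using close(1) d(2) z[OF K(1)] z[OF K(2)] by (simp add: w_def Tdiff P_diff TY)
    let ?A = "N (x + t *\<^sub>R w)" and ?B = "N (u + t *\<^sub>R T w)"
    have A: "?A = N (T x + t *\<^sub>R T w)"
      using x w TN[of "x + t *\<^sub>R w"] by (simp add: Tadd Tsc)
    have AB: "?A \<le> ?B + \<epsilon>"
      unfolding A using N_triangle[of "T x + t *\<^sub>R T w" "u + t *\<^sub>R T w"] Tx TY x u w by simp
    have A2: "?A \<le> 1 + 2 * t"
    proof -
      have "?A \<le> N x + N (t *\<^sub>R w)" using x w by (intro N_add) auto
      also have "\<dots> = 1 + t * N w" using x w t by (simp add: N_scaleR)
      also have "\<dots> \<le> 1 + t * 2" using w t by (intro add_left_mono mult_left_mono) auto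
      finally show ?thesis by (simp add: mult.commute)
    qed
    have nn: "0 \<le> ?A" "0 \<le> ?B" using x w u TY by auto
    have "?A\<^sup>2 - 2 * \<epsilon> * ?A \<le> ?B\<^sup>2"
    proof (cases "\<epsilon> \<le> ?A")
      case True
      then have "(?A - \<epsilon>)\<^sup>2 \<le> ?B\<^sup>2" using AB by (intro power_mono) auto
      moreover have "(?A - \<epsilon>)\<^sup>2 = ?A\<^sup>2 - 2 * \<epsilon> * ?A + \<epsilon>\<^sup>2" by (simp add: power2_diff)
      ultimately show ?thesis using zero_le_power2[of \<epsilon>] by linarith
    next
      case False
      then have "?A * ?A \<le> (2 * \<epsilon>) * ?A" using nn by (intro mult_right_mono) auto
      then have "?A\<^sup>2 - 2 * \<epsilon> * ?A \<le> 0" by (simp add: power2_eq_square)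
      also have "0 \<le> ?B\<^sup>2" by simp
      finally show ?thesis .
    qed
    moreover have "2 * \<epsilon> * ?A \<le> t\<^sup>2 / 64"
    proof -
      have "2 * \<epsilon> * ?A \<le> 2 * \<epsilon> * (1 + 2 * t)" using A2 \<epsilon> by (intro mult_left_mono) auto
      also have "\<dots> = t\<^sup>2 / 64" using t by (simp add: \<epsilon>_def divide_simps)
      finally show ?thesis .
    qed
    moreover have "- (t\<^sup>2 / 64) \<le> 2 * t * (g i - g j)"
    proof -
      have "\<bar>2 * t * (g i - g j)\<bar> = 2 * t * \<bar>g i - g j\<bar>" using t by (simp add: abs_mult)
      also have "\<dots> \<le> 2 * t * (t / 128)" using close(2) d(3) t by (intro mult_left_mono) auto
      also have "\<dots> = t\<^sup>2 / 64" by (simp add: power2_eq_square)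
      finally show ?thesis by linarith
    qed
    moreover have "1 - \<eta> + 2 * t * (g i - g j) + t\<^sup>2 / 16 \<le> ?A\<^sup>2"
      unfolding w_def by (rule low[OF K ij(3)])
    ultimately show "1 + t\<^sup>2 / 64 \<le> ?B\<^sup>2" using \<eta>(3) by (simp add: field_simps)
  qed
qed

text \<open>The budget 4 t^2 is made up of 2 t^2 from the ellipsoid, t^2 from the linear term, and
  t^2/2 each for imperfect contact and for the isometry. A lower bound for \<open>N y\<close> must
  be secured separately, since the \<open>z i\<close> are not given as separated.\<close>

lemma unit_step_upper:
  assumes u: "u \<in> Y" "N u = 1" and t: "0 < t" and \<delta>: "0 < \<delta>"
  obtains y where "y \<in> Y" "1/8 \<le> N y" "N y \<le> 2" "norm (P y) \<le> \<delta>"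
    "(N (u + t *\<^sub>R y))\<^sup>2 \<le> 1 + 4 * t\<^sup>2"
proof -
  define d where "d = min \<delta> (t / 2)"
  have d: "0 < d" "d \<le> \<delta>" "d \<le> t / 2" using \<delta> t by (auto simp: d_def)
  obtain K :: nat where K: "65 < K" and pig: "\<And>f. (\<And>i. i < K \<Longrightarrow> f i \<in> S \<times> {-1..1::real}) \<Longrightarrow>
    \<exists>J\<subseteq>{..<K}. 65 \<le> card J \<and> (\<forall>i\<in>J. \<forall>j\<in>J. dist (f i) (f j) < d)"
    using compact_pigeonhole[OF compact_Times[OF S(1) compact_Icc] d(1)] by blast
  \<comment> \<open>The solution of (1 + 3 t^2) / (1 - \<eta>) = 1 + 3 t^2 + t^2/2.\<close>
  define \<eta> where "\<eta> = (t\<^sup>2 / 2) / (1 + 3 * t\<^sup>2 + t\<^sup>2 / 2)"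
  have \<eta>: "0 < \<eta>" "\<eta> < 1" "(1 + 3 * t\<^sup>2) / (1 - \<eta>) = 1 + 3 * t\<^sup>2 + t\<^sup>2 / 2"
  proof -
    have p: "0 < 1 + 3 * t\<^sup>2 + t\<^sup>2 / 2" using zero_le_power2[of t] by linarith
    show "0 < \<eta>" unfolding \<eta>_def using t p by (intro divide_pos_pos) auto
    show "\<eta> < 1" unfolding \<eta>_def pos_divide_less_eq[OF p] mult_1 using zero_le_power2[of t] by linarith
    have "1 - \<eta> = (1 + 3 * t\<^sup>2) / (1 + 3 * t\<^sup>2 + t\<^sup>2 / 2)"
    proof -
      have "1 - \<eta> = (1 + 3 * t\<^sup>2 + t\<^sup>2 / 2) / (1 + 3 * t\<^sup>2 + t\<^sup>2 / 2) - \<eta>" using p by simp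
      then show ?thesis unfolding \<eta>_def by (simp only: diff_divide_distrib[symmetric]) simp
    qed
    moreover have "0 < 1 + 3 * t\<^sup>2" using zero_le_power2[of t] by linarith
    ultimately show "(1 + 3 * t\<^sup>2) / (1 - \<eta>) = 1 + 3 * t\<^sup>2 + t\<^sup>2 / 2" by simp
  qed
  have "0 < K" using K by simp
  from Dvoretzky_Rogers_upper[OF this \<eta>(1,2)]
  obtain x z g where x: "x \<in> Y" "N x = 1" and z: "\<And>i. i < K \<Longrightarrow> z i \<in> Y"
    "\<And>i. i < K \<Longrightarrow> 1/4 \<le> N (z i)" "\<And>i. i < K \<Longrightarrow> N (z i) \<le> 1"
    and g: "\<And>i. i < K \<Longrightarrow> \<bar>g i\<bar> \<le> (1::real)"
    and sum_z: "\<And>S. S \<subseteq> {..<K} \<Longrightarrow> (N (\<Sum>i\<in>S. z i))\<^sup>2 \<le> card S"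
    and up: "\<And>i j t. i < K \<Longrightarrow> j < K \<Longrightarrow> i \<noteq> j \<Longrightarrow>
      (N (x + t *\<^sub>R (z i - z j)))\<^sup>2 \<le> (1 + 2 * \<bar>t\<bar> * \<bar>g i - g j\<bar> + 2 * t\<^sup>2) / (1 - \<eta>)" by blast
  define \<epsilon> where "\<epsilon> = min 1 (t\<^sup>2 / (2 * (3 + 4 * t)))"
  have \<epsilon>: "0 < \<epsilon>" "\<epsilon> \<le> 1" "\<epsilon> \<le> t\<^sup>2 / (2 * (3 + 4 * t))" using t by (auto simp: \<epsilon>_def)
  obtain T where TY: "\<And>y. y \<in> Y \<Longrightarrow> T y \<in> Y" and TN: "\<And>y. y \<in> Y \<Longrightarrow> N (T y) = N y"
    and Tadd: "\<And>y z. y \<in> Y \<Longrightarrow> z \<in> Y \<Longrightarrow> T (y + z) = T y + T z"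
    and Tdiff: "\<And>y z. y \<in> Y \<Longrightarrow> z \<in> Y \<Longrightarrow> T (y - z) = T y - T z"
    and Tsc: "\<And>y r. y \<in> Y \<Longrightarrow> T (r *\<^sub>R y) = r *\<^sub>R T y"
    and Tx: "N (T x - u) < \<epsilon>"
    by (rule near_isometry[OF x u \<epsilon>(1)]) blast
  have "(P (T (z i)), g i) \<in> S \<times> {-1..1}" if "i < K" for i
    using S(2)[of "T (z i)"] TY TN z[OF that] g[OF that] by (auto simp: abs_le_iff)
  then obtain J where J: "J \<subseteq> {..<K}" "65 \<le> card J"
    "\<And>i j. i \<in> J \<Longrightarrow> j \<in> J \<Longrightarrow> dist (P (T (z i)), g i) (P (T (z j)), g j) < d"
    using pig[of "\<lambda>i. (P (T (z i)), g i)"] by blast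
  have JK: "i < K" if "i \<in> J" for i using that J(1) by auto
  have finJ: "finite J" using J(1) finite_subset by blast
  obtain i where i: "i \<in> J" using J(2) by fastforce
  \<comment> \<open>If s vectors were all within 1/8 of one vector of norm at least 1/4, their sum
    would have norm at least s/8, but it is at most sqrt s. This fails as soon as s > 64, whence the
    65.\<close>
  have "\<exists>j\<in>J. 1/8 \<le> N (z i - z j)"
  proof (rule ccontr)
    assume "\<not> ?thesis"
    then have lt: "N (z i - z j) \<le> 1/8" if "j \<in> J" for j using that by fastforce
    let ?s = "real (card J)" and ?Z = "\<Sum>j\<in>J. z j"
    have ZY: "?Z \<in> Y" using z(1) JK by blast
    have "?s * (1/4) \<le> ?s * N (z i)" using z(2)[OF JK[OF i]] by (intro mult_left_mono) auto
    also have "\<dots> = N (?s *\<^sub>R z i)" using z(1)[OF JK[OF i]] by (simp add: N_scaleR)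
    also have "\<dots> \<le> N ?Z + N (?s *\<^sub>R z i - ?Z)"
      using z(1)[OF JK[OF i]] ZY by (intro N_triangle) auto
    also have "?s *\<^sub>R z i - ?Z = (\<Sum>j\<in>J. z i - z j)"
      by (simp add: sum_subtractf sum_constant_scaleR)
    also have "N (\<Sum>j\<in>J. z i - z j) \<le> (\<Sum>j\<in>J. N (z i - z j))"
      using finJ z(1) JK i by (intro N_sum) auto
    also have "\<dots> \<le> (\<Sum>j\<in>J. 1/8)" using lt by (intro sum_mono) auto
    finally have "?s * (1/8) \<le> N ?Z" by simp
    then have "(?s * (1/8))\<^sup>2 \<le> (N ?Z)\<^sup>2" by (intro power_mono) auto
    then have "(?s * (1/8))\<^sup>2 \<le> ?s" using sum_z[OF J(1)] by linarith
    then have "?s * ?s \<le> 64 * ?s" by (simp add: power2_eq_square)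
    then show False using J(2) by simp
  qed
  then obtain j where j: "j \<in> J" "1/8 \<le> N (z i - z j)" by blast
  have ij: "i \<noteq> j" using j(2) N_eq_0[of 0] by auto
  have K: "i < K" "j < K" using JK i j by auto
  define w where "w = z i - z j"
  have w: "w \<in> Y" "1/8 \<le> N w" "N w \<le> 2"
    using z[OF K(1)] z[OF K(2)] j(2) N_diff[of "z i" "z j"] by (auto simp: w_def)
  have close: "norm (P (T (z i)) - P (T (z j))) < d" "\<bar>g i - g j\<bar> < d"
    using J(3)[OF i j(1)] dist_fst_le[of "(P (T (z i)), g i)" "(P (T (z j)), g j)"]
      dist_snd_le[of "(P (T (z i)), g i)" "(P (T (z j)), g j)"]
    by (auto simp: dist_norm)
  show ?thesis
  proof (rule that[of "T w"])
    show "T w \<in> Y" "1/8 \<le> N (T w)" "N (T w) \<le> 2" using w TY TN by auto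
    show "norm (P (T w)) \<le> \<delta>"
      using close(1) d(2) z[OF K(1)] z[OF K(2)] by (simp add: w_def Tdiff P_diff TY)
    let ?A = "N (x + t *\<^sub>R w)" and ?B = "N (u + t *\<^sub>R T w)"
    have A: "?A = N (T x + t *\<^sub>R T w)"
      using x w TN[of "x + t *\<^sub>R w"] by (simp add: Tadd Tsc)
    have AB: "?B \<le> ?A + \<epsilon>"
      unfolding A using N_triangle[of "u + t *\<^sub>R T w" "T x + t *\<^sub>R T w"] Tx TY x u w N_minus[of u "T x"] by simp
    have A2: "?A \<le> 1 + 2 * t"
    proof -
      have "?A \<le> N x + N (t *\<^sub>R w)" using x w by (intro N_add) auto
      also have "\<dots> = 1 + t * N w" using x w t by (simp add: N_scaleR)
      also have "\<dots> \<le> 1 + t * 2" using w t by (intro add_left_mono mult_left_mono) auto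
      finally show ?thesis by (simp add: mult.commute)
    qed
    have nn: "0 \<le> ?A" "0 \<le> ?B" using x w u TY by auto
    have "?B\<^sup>2 \<le> (?A + \<epsilon>)\<^sup>2" using AB nn by (intro power_mono) auto
    also have "\<dots> = ?A\<^sup>2 + \<epsilon> * (2 * ?A + \<epsilon>)" by (simp add: power2_eq_square algebra_simps)
    also have "\<epsilon> * (2 * ?A + \<epsilon>) \<le> (t\<^sup>2 / (2 * (3 + 4 * t))) * (3 + 4 * t)"
      using \<epsilon> A2 nn t by (intro mult_mono) auto
    also have "\<dots> = t\<^sup>2 / 2" using t by (simp add: divide_simps)
    also have "?A\<^sup>2 \<le> (1 + 2 * \<bar>t\<bar> * \<bar>g i - g j\<bar> + 2 * t\<^sup>2) / (1 - \<eta>)"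
      unfolding w_def by (rule up[OF K ij])
    also have "\<dots> \<le> (1 + 3 * t\<^sup>2) / (1 - \<eta>)"
    proof -
      have "2 * \<bar>t\<bar> * \<bar>g i - g j\<bar> \<le> 2 * \<bar>t\<bar> * (t / 2)" using close(2) d(3) by (intro mult_left_mono) auto
      also have "\<dots> = t\<^sup>2" using t by (simp add: power2_eq_square)
      finally show ?thesis using \<eta> by (intro divide_right_mono) auto
    qed
    also note \<eta>(3)
    finally show "?B\<^sup>2 \<le> 1 + 4 * t\<^sup>2" by simp
  qed
qed

text \<open>For nonzero \<open>v\<close> take the unit step at v / N v with t = 1 / N v and multiply
  by \<open>(N v)^2\<close>: the gain becomes 1/64, whatever \<open>N v\<close> is. For v = 0 the
  bound 1/8 on \<open>N y\<close> gives the same gain.\<close>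

lemma step_lower:
  assumes v: "v \<in> Y" and \<delta>: "0 < \<delta>"
  shows "\<exists>y\<in>Y. 1/8 \<le> N y \<and> N y \<le> 2 \<and> norm (P y) \<le> \<delta> \<and> (N v)\<^sup>2 + 1/64 \<le> (N (v + y))\<^sup>2"
proof (cases "v = 0")
  case True
  obtain u where u: "u \<in> Y" "N u = 1" by (rule unit_vector)
  obtain y where y: "y \<in> Y" "1/8 \<le> N y" "N y \<le> 2" "norm (P y) \<le> \<delta>"
    by (rule unit_step_lower[OF u _ \<delta>, of 1]) auto
  moreover have "(1/8)\<^sup>2 \<le> (N y)\<^sup>2" using y by (intro power_mono) auto
  then have "(N v)\<^sup>2 + 1/64 \<le> (N (v + y))\<^sup>2" using True N_eq_0[of 0] by (simp add: power2_eq_square)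
  ultimately show ?thesis by blast
next
  case False
  define s where "s = N v"
  have s: "0 < s" using False v N_eq_0[OF v] N_nonneg[OF v] by (simp add: s_def less_le)
  have u: "(1 / s) *\<^sub>R v \<in> Y" "N ((1 / s) *\<^sub>R v) = 1" using v s by (auto simp: N_scaleR s_def)
  obtain y where y: "y \<in> Y" "1/8 \<le> N y" "N y \<le> 2" "norm (P y) \<le> \<delta>"
    and l: "1 + (1 / s)\<^sup>2 / 64 \<le> (N ((1 / s) *\<^sub>R v + (1 / s) *\<^sub>R y))\<^sup>2"
    using unit_step_lower[OF u _ \<delta>, of "1 / s"] s by auto
  have "N ((1 / s) *\<^sub>R v + (1 / s) *\<^sub>R y) = (1 / s) * N (v + y)"
    using N_scaleR[of "v + y" "1 / s"] v y(1) s by (simp add: scaleR_add_right)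
  then have "s\<^sup>2 * (1 + (1 / s)\<^sup>2 / 64) \<le> s\<^sup>2 * ((1 / s) * N (v + y))\<^sup>2"
    using l by (intro mult_left_mono) auto
  then have "s\<^sup>2 + 1/64 \<le> (N (v + y))\<^sup>2" using s by (simp add: power_divide distrib_left)
  then show ?thesis using y unfolding s_def by blast
qed

text \<open>The same rescaling turns 4 t^2 into the constant 4; at v = 0 the bound N y \<le> 2 gives
  it directly.\<close>

lemma step_upper:
  assumes v: "v \<in> Y" and \<delta>: "0 < \<delta>"
  shows "\<exists>y\<in>Y. 1/8 \<le> N y \<and> N y \<le> 2 \<and> norm (P y) \<le> \<delta> \<and> (N (v + y))\<^sup>2 \<le> (N v)\<^sup>2 + 4"
proof (cases "v = 0")
  case True
  obtain u where u: "u \<in> Y" "N u = 1" by (rule unit_vector)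
  obtain y where y: "y \<in> Y" "1/8 \<le> N y" "N y \<le> 2" "norm (P y) \<le> \<delta>"
    by (rule unit_step_upper[OF u _ \<delta>, of 1]) auto
  moreover have "(N y)\<^sup>2 \<le> 2\<^sup>2" using y by (intro power_mono) auto
  then have "(N (v + y))\<^sup>2 \<le> (N v)\<^sup>2 + 4" using True N_eq_0[of 0] by simp
  ultimately show ?thesis by blast
next
  case False
  define s where "s = N v"
  have s: "0 < s" using False v N_eq_0[OF v] N_nonneg[OF v] by (simp add: s_def less_le)
  have u: "(1 / s) *\<^sub>R v \<in> Y" "N ((1 / s) *\<^sub>R v) = 1" using v s by (auto simp: N_scaleR s_def)
  obtain y where y: "y \<in> Y" "1/8 \<le> N y" "N y \<le> 2" "norm (P y) \<le> \<delta>"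
    and l: "(N ((1 / s) *\<^sub>R v + (1 / s) *\<^sub>R y))\<^sup>2 \<le> 1 + 4 * (1 / s)\<^sup>2"
    using unit_step_upper[OF u _ \<delta>, of "1 / s"] s by auto
  have "N ((1 / s) *\<^sub>R v + (1 / s) *\<^sub>R y) = (1 / s) * N (v + y)"
    using N_scaleR[of "v + y" "1 / s"] v y(1) s by (simp add: scaleR_add_right)
  then have "s\<^sup>2 * ((1 / s) * N (v + y))\<^sup>2 \<le> s\<^sup>2 * (1 + 4 * (1 / s)\<^sup>2)"
    using l by (intro mult_left_mono) auto
  then have "(N (v + y))\<^sup>2 \<le> s\<^sup>2 + 4" using s by (simp add: power_divide distrib_left)
  then show ?thesis using y unfolding s_def by blast
qed

end

end

subsection \<open>Bases with (p,q)-estimates\<close>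

lemma powr_bound_imp_exponent_le:
  assumes "\<And>n::nat. 1 \<le> n \<Longrightarrow> real n powr \<alpha> \<le> D * real n powr \<beta>"
  shows "\<alpha> \<le> \<beta>"
proof (rule ccontr)
  assume "\<not> \<alpha> \<le> \<beta>"
  define s where "s = \<alpha> - \<beta>"
  have s: "0 < s" using \<open>\<not> \<alpha> \<le> \<beta>\<close> by (simp add: s_def)
  define E where "E = max D 1"
  obtain n :: nat where n: "E powr (1 / s) < real n" using reals_Archimedean2 by blast
  have "0 < E powr (1 / s)" by (simp add: E_def)
  with n have n1: "1 \<le> n" by (cases n) auto
  have "E = (E powr (1 / s)) powr s" using s by (simp add: powr_powr E_def)
  also have "\<dots> < real n powr s" using n s by (intro powr_less_mono2) auto
  finally have "D < real n powr s" by (simp add: E_def)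
  then have "D * real n powr \<beta> < real n powr s * real n powr \<beta>"
    using n1 by (intro mult_strict_right_mono) auto
  also have "\<dots> = real n powr \<alpha>" by (simp add: s_def flip: powr_add)
  finally show False using assms[OF n1] by simp
qed

locale pq_basis = banach_space_over smul
  for smul :: "'k::{real_normed_field,banach} \<Rightarrow> 'a::banach \<Rightarrow> 'a" +
  fixes e :: "nat \<Rightarrow> 'a" and p q C :: real
  assumes basis: "schauder_basis smul e" and p_pos: "0 < p" and q_pos: "0 < q" and C_pos: "0 < C"
    and lower_est: "(\<And>k. 1 \<le> k \<Longrightarrow> k < n \<Longrightarrow> block_less smul e (x k) (x (Suc k))) \<Longrightarrow>
      1 / C * (\<Sum>k=1..n. norm (x k) powr p) powr (1 / p) \<le> norm (\<Sum>k=1..n. x k)"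
    and upper_est: "(\<And>k. 1 \<le> k \<Longrightarrow> k < n \<Longrightarrow> block_less smul e (x k) (x (Suc k))) \<Longrightarrow>
      norm (\<Sum>k=1..n. x k) \<le> C * (\<Sum>k=1..n. norm (x k) powr q) powr (1 / q)"
begin

abbreviation coord :: "'a \<Rightarrow> nat \<Rightarrow> 'k" where "coord \<equiv> coeffs smul e"

definition P :: "nat \<Rightarrow> 'a \<Rightarrow> 'a" where
  "P m x = (\<Sum>i<m. smul (coord x i) (e i))"

lemma coord_sums: "(\<lambda>i. smul (coord x i) (e i)) sums x"
  using theI'[OF spec[OF basis[unfolded schauder_basis_def], of x]] unfolding coeffs_def .

lemma coord_unique: "(\<lambda>i. smul (a i) (e i)) sums x \<Longrightarrow> coord x = a"
  using basis coord_sums[of x] unfolding schauder_basis_def by blast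

lemma coord_diff: "coord (x - y) = (\<lambda>i. coord x i - coord y i)"
  by (rule coord_unique) (simp add: scale_left_diff_distrib sums_diff[OF coord_sums coord_sums])

lemma coord_P: "coord (P m x) = (\<lambda>i. if i < m then coord x i else 0)"
proof (rule coord_unique)
  have "(\<lambda>i. smul (if i < m then coord x i else 0) (e i)) sums (\<Sum>i\<in>{..<m}. smul (if i < m then coord x i else 0) (e i))"
    by (rule sums_finite) auto
  then show "(\<lambda>i. smul (if i < m then coord x i else 0) (e i)) sums P m x"
    by (simp add: P_def)
qed

lemma e_nonzero: "e i \<noteq> 0"
proof
  assume "e i = 0"
  then have "(\<lambda>j. smul (if j = i then 1 else 0) (e j)) = (\<lambda>j. 0)" by auto
  then have "coord 0 = (\<lambda>j. if j = i then 1 else 0)" by (intro coord_unique) simp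
  moreover have "coord 0 = (\<lambda>j. 0)" by (intro coord_unique) simp
  ultimately have "(1::'k) = 0" by (metis (full_types))
  then show False by simp
qed

lemma P_diff: "P m (x - y) = P m x - P m y"
  by (simp add: P_def coord_diff scale_left_diff_distrib sum_subtractf)

lemma P_tendsto: "(\<lambda>m. P m x) \<longlonglongrightarrow> x"
  using coord_sums[of x] by (simp add: sums_def P_def)

lemma supp_nonempty: "x \<noteq> 0 \<Longrightarrow> supp smul e x \<noteq> {}"
  using coord_sums[of x] sums_unique2[OF _ sums_zero] by (fastforce simp: supp_def)

lemma supp_P: "supp smul e (P m x) \<subseteq> {..<m}"
  by (auto simp: supp_def coord_P)

lemma supp_tail: "supp smul e (x - P m x) \<subseteq> {m..}"
  by (auto simp: supp_def coord_P coord_diff split: if_splits)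

lemma block_lessI:
  assumes "supp smul e x \<subseteq> {..<m}" "supp smul e y \<subseteq> {m..}" "x \<noteq> 0" "y \<noteq> 0"
  shows "block_less smul e x y"
proof -
  note ne = supp_nonempty[OF assms(3)] supp_nonempty[OF assms(4)]
  have fin: "finite (supp smul e x)" using assms(1) finite_subset by blast
  have "Max (supp smul e x) < m" using Max_in[OF fin ne(1)] assms(1) by auto
  also have "m \<le> Inf (supp smul e y)" using Inf_nat_def1[OF ne(2)] assms(2) by auto
  finally show ?thesis using ne fin by (simp add: block_less_def)
qed

text \<open>
  The lower estimate for the two blocks \<open>P m x\<close> and \<open>x - P m x\<close> bounds the partial sum projections
  without an appeal to the open mapping theorem.
\<close>

lemma norm_P: "norm (P m x) \<le> (C + 1) * norm x"
proof -
  consider "P m x = 0" | "P m x = x" | "P m x \<noteq> 0" "x - P m x \<noteq> 0" by fastforce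
  then show ?thesis
  proof cases
    case 3
    define w where "w k = (if k = 1 then P m x else x - P m x)" for k :: nat
    have "block_less smul e (w k) (w (Suc k))" if "1 \<le> k" "k < 2" for k
      using that block_lessI[OF supp_P supp_tail 3] by (simp add: w_def)
    from lower_est[where n = 2 and x = w, OF this]
    have "1 / C * (\<Sum>k=1..2. norm (w k) powr p) powr (1 / p) \<le> norm (\<Sum>k=1..2. w k)" by simp
    moreover have "(\<Sum>k=1..2. w k) = x" by (simp add: w_def numeral_2_eq_2)
    moreover have "norm (P m x) \<le> (\<Sum>k=1..2. norm (w k) powr p) powr (1 / p)"
    proof -
      have "norm (P m x) = (norm (P m x) powr p) powr (1 / p)" using p_pos by (simp add: powr_powr)
      also have "\<dots> \<le> (\<Sum>k=1..2. norm (w k) powr p) powr (1 / p)"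
        using p_pos by (intro powr_mono2) (auto simp: w_def numeral_2_eq_2)
      finally show ?thesis .
    qed
    ultimately have "norm (P m x) \<le> C * norm x" using C_pos by (simp add: divide_le_eq mult.commute)
    also have "\<dots> \<le> (C + 1) * norm x" by (simp add: mult_right_mono)
    finally show ?thesis .
  qed (use C_pos in \<open>auto simp: mult_le_cancel_right1\<close>)
qed

text \<open>Each coordinate is bounded because its term is a difference of two consecutive partial
  sums. Bounded closed sets of scalars are compact, and \<open>P m x\<close> lies in a finite sum of
  their images.\<close>

lemma P_compact:
  "\<exists>S. compact S \<and> (\<forall>x. norm x \<le> r \<longrightarrow> P m x \<in> S)"
proof -
  define L where "L i = 2 * (C + 1) * r / norm (e i)" for i
  have bl: "bounded_linear (\<lambda>c. smul c x)" for x
  proof (rule bounded_linear_intro[where K = "norm x"])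
    show "smul (s *\<^sub>R c) x = s *\<^sub>R smul c x" for s c
      unfolding scaleR_conv_of_real[of s c] by (simp add: scale_of_real flip: scale_scale)
  qed (simp_all add: scale_left_distrib norm_scale)
  let ?S = "{\<Sum>i<m. v i | v. \<forall>i\<in>{..<m}. v i \<in> (\<lambda>c. smul c (e i)) ` cball 0 (L i)}"
  have "compact ?S"
    by (intro compact_set_sum compact_continuous_image compact_cball_real_normed_field
        linear_continuous_on bl) auto
  moreover have "P m x \<in> ?S" if x: "norm x \<le> r" for x
  proof -
    have "coord x i \<in> cball 0 (L i)" for i
    proof -
      have "smul (coord x i) (e i) = P (Suc i) x - P i x" by (simp add: P_def)
      then have "norm (coord x i) * norm (e i) = norm (P (Suc i) x - P i x)"
        by (metis norm_scale)
      also have "\<dots> \<le> (C + 1) * norm x + (C + 1) * norm x"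
        using norm_triangle_ineq4[of "P (Suc i) x" "P i x"] norm_P[of "Suc i" x] norm_P[of i x] by linarith
      also have "\<dots> = 2 * (C + 1) * norm x" by (simp add: algebra_simps)
      also have "\<dots> \<le> 2 * (C + 1) * r" using x C_pos by (intro mult_left_mono) auto
      finally show ?thesis using e_nonzero[of i] by (simp add: L_def le_divide_eq)
    qed
    then show ?thesis unfolding P_def by blast
  qed
  ultimately show ?thesis by blast
qed

text \<open>Cutting off the head below \<open>m\<close> and a far tail changes \<open>y\<close> by
  at most \<delta> each.\<close>

lemma block_approximation:
  assumes "norm (P m y) \<le> \<delta>" "0 < \<delta>" "2 * \<delta> < norm y"
  obtains x m' where "norm (x - y) \<le> 2 * \<delta>" "x \<noteq> 0" "supp smul e x \<subseteq> {m..<m'}"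
proof -
  obtain M where M: "\<And>n. M \<le> n \<Longrightarrow> norm (P n y - y) < \<delta>"
    using LIMSEQ_D[OF P_tendsto[of y] assms(2)] by blast
  define m' where "m' = max m M"
  define x where "x = P m' y - P m y"
  have "norm (x - y) \<le> norm (P m' y - y) + norm (P m y)"
    using norm_triangle_ineq4[of "P m' y - y" "P m y"] by (simp add: x_def algebra_simps)
  then have xy: "norm (x - y) \<le> 2 * \<delta>" using M[of m'] assms(1) by (simp add: m'_def)
  moreover have "x \<noteq> 0" using xy assms(3) by auto
  moreover have "supp smul e x \<subseteq> {m..<m'}"
    by (auto simp: supp_def x_def coord_diff coord_P m'_def split: if_splits)
  ultimately show ?thesis using that by blast
qed

text \<open>The relation \<open>R n v\<close> abstracts the growth of the sum \<open>v\<close> of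
  the first \<open>n\<close> increments, so that one construction serves both estimates. Only the
  exact increments are added up to \<open>w\<close>; the blocks \<open>x k\<close> deviate from them
  by at most 2 \<delta> each, which 4 \<delta> \<le> c keeps below c/2.\<close>

lemma block_sequence:
  assumes \<delta>: "0 < \<delta>" and R0: "0 \<in> V" "R 0 0"
    and step: "\<And>n v m. v \<in> V \<Longrightarrow> R n v \<Longrightarrow>
      \<exists>y. v + y \<in> V \<and> c \<le> norm y \<and> norm y \<le> c' \<and> norm (P m y) \<le> \<delta> \<and> R (Suc n) (v + y)"
    and c: "4 * \<delta> \<le> c"
  shows "\<exists>w x. w \<in> V \<and> R n w \<and> norm ((\<Sum>k=1..n. x k) - w) \<le> 2 * real n * \<delta> \<and>
    (\<forall>k. 1 \<le> k \<longrightarrow> k \<le> n \<longrightarrow> c / 2 \<le> norm (x k) \<and> norm (x k) \<le> c' + 2 * \<delta>) \<and>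
    (\<forall>k. 1 \<le> k \<longrightarrow> k < n \<longrightarrow> block_less smul e (x k) (x (Suc k)))"
proof -
  \<comment> \<open>The induction also carries a bound \<open>m\<close> on all supports so far; the
    next increment is made small under \<open>P m\<close>.\<close>
  have "\<exists>w x m. w \<in> V \<and> R n w \<and> norm ((\<Sum>k=1..n. x k) - w) \<le> 2 * real n * \<delta> \<and>
    (\<forall>k. 1 \<le> k \<longrightarrow> k \<le> n \<longrightarrow> c / 2 \<le> norm (x k) \<and> norm (x k) \<le> c' + 2 * \<delta> \<and> supp smul e (x k) \<subseteq> {..<m}) \<and>
    (\<forall>k. 1 \<le> k \<longrightarrow> k < n \<longrightarrow> block_less smul e (x k) (x (Suc k)))"
  proof (induction n)
    case 0
    show ?case using R0 by (intro exI[of _ 0]) auto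
  next
    case (Suc n)
    then obtain w x m where w: "w \<in> V" "R n w" "norm ((\<Sum>k=1..n. x k) - w) \<le> 2 * real n * \<delta>"
      and x: "\<And>k. 1 \<le> k \<Longrightarrow> k \<le> n \<Longrightarrow> c / 2 \<le> norm (x k) \<and> norm (x k) \<le> c' + 2 * \<delta> \<and> supp smul e (x k) \<subseteq> {..<m}"
      and bl: "\<And>k. 1 \<le> k \<Longrightarrow> k < n \<Longrightarrow> block_less smul e (x k) (x (Suc k))" by blast
    obtain y where y: "w + y \<in> V" "c \<le> norm y" "norm y \<le> c'" "norm (P m y) \<le> \<delta>" "R (Suc n) (w + y)"
      using step[OF w(1,2)] by blast
    have "2 * \<delta> < norm y" using y(2) c \<delta> by linarith
    from block_approximation[OF y(4) \<delta> this]
    obtain z m' where z: "norm (z - y) \<le> 2 * \<delta>" "z \<noteq> 0" "supp smul e z \<subseteq> {m..<m'}" by blast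
    define x' where "x' = x(Suc n := z)"
    have x'_old: "x' k = x k" if "k \<le> n" for k using that by (simp add: x'_def)
    have sum_eq: "(\<Sum>k=1..Suc n. x' k) = (\<Sum>k=1..n. x k) + z"
      using x'_old by (simp add: x'_def)
    have "norm ((\<Sum>k=1..Suc n. x' k) - (w + y)) \<le> norm ((\<Sum>k=1..n. x k) - w) + norm (z - y)"
      unfolding sum_eq using norm_triangle_ineq[of "(\<Sum>k=1..n. x k) - w" "z - y"] by (simp add: algebra_simps)
    also have "\<dots> \<le> 2 * real (Suc n) * \<delta>" using w(3) z(1) by (simp add: algebra_simps)
    finally have 1: "norm ((\<Sum>k=1..Suc n. x' k) - (w + y)) \<le> 2 * real (Suc n) * \<delta>" .
    have zn: "c / 2 \<le> norm z" "norm z \<le> c' + 2 * \<delta>"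
      using norm_triangle_ineq2[of y z] norm_triangle_ineq2[of z y] z(1) y(2,3) c
      by (simp_all add: norm_minus_commute)
    have 2: "c / 2 \<le> norm (x' k) \<and> norm (x' k) \<le> c' + 2 * \<delta> \<and> supp smul e (x' k) \<subseteq> {..<max m m'}"
      if k: "1 \<le> k" "k \<le> Suc n" for k
    proof (cases "k = Suc n")
      case True
      then show ?thesis using zn z(3) by (auto simp: x'_def)
    next
      case False
      then have "k \<le> n" using k by simp
      then show ?thesis using x[OF k(1)] x'_old[of k] by auto
    qed
    have 3: "block_less smul e (x' k) (x' (Suc k))" if k: "1 \<le> k" "k < Suc n" for k
    proof (cases "k = n")
      case True
      have "x n \<noteq> 0" using x[of n] k True c \<delta> by fastforce
      then have "block_less smul e (x n) z"
        using x[of n] k True z by (intro block_lessI[of _ m]) auto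
      then show ?thesis using True by (simp add: x'_def)
    next
      case False
      then show ?thesis using bl[of k] k x'_old by auto
    qed
    show ?case using y(1,5) 1 2 3 by blast
  qed
  then show ?thesis by blast
qed

end

section \<open>Growth of block sums and the two exponent inequalities\<close>

locale transitive_in_pq = pq_basis smul e p q C + transitive_subspace smul Y N
  for smul :: "'k::{real_normed_field,banach} \<Rightarrow> 'a::banach \<Rightarrow> 'a"
    and e p q C Y N
begin

text \<open>The hypothesis \<open>step\<close> ranges over all maps \<open>P\<close> because the
  cut-off, and with it the partial sum projection, changes at every stage.\<close>

lemma block_sequence_in_Y:
  assumes ab: "0 < a" "0 < b" "\<And>y. y \<in> Y \<Longrightarrow> a * norm y \<le> N y" "\<And>y. y \<in> Y \<Longrightarrow> N y \<le> b * norm y"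
    and n: "1 \<le> n" and R0: "R 0 0"
    and step: "\<forall>S P k v \<delta>. compact S \<longrightarrow> (\<forall>x\<in>Y. N x \<le> 1 \<longrightarrow> P x \<in> S) \<longrightarrow>
      (\<forall>x\<in>Y. \<forall>y\<in>Y. P (x - y) = P x - P y) \<longrightarrow> v \<in> Y \<longrightarrow> 0 < \<delta> \<longrightarrow> R k v \<longrightarrow>
      (\<exists>y\<in>Y. 1/8 \<le> N y \<and> N y \<le> 2 \<and> norm (P y :: 'a) \<le> \<delta> \<and> R (Suc k) (v + y))"
  shows "\<exists>w x. w \<in> Y \<and> R n w \<and> \<bar>norm (\<Sum>k=1..n. x k) - norm w\<bar> \<le> 1 \<and>
    (\<forall>k. 1 \<le> k \<longrightarrow> k \<le> n \<longrightarrow> 1 / (16 * b) \<le> norm (x k) \<and> norm (x k) \<le> 2 / a + 1) \<and>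
    (\<forall>k. 1 \<le> k \<longrightarrow> k < n \<longrightarrow> block_less smul e (x k) (x (Suc k)))"
proof -
  define c where "c = 1 / (8 * b)"
  \<comment> \<open>Since \<open>n\<close> is fixed in advance, the tolerance may depend on it: the
    total deviation 2 n \<delta> stays at most 1.\<close>
  define \<delta> where "\<delta> = min (c / 4) (1 / (2 * real n))"
  have c: "0 < c" using ab by (simp add: c_def)
  have \<delta>: "0 < \<delta>" "4 * \<delta> \<le> c" "\<delta> \<le> 1 / (2 * real n)" using c n by (auto simp: \<delta>_def)
  have n\<delta>: "2 * real n * \<delta> \<le> 1" using \<delta>(3) n by (simp add: field_simps)
  have "\<delta> * 1 \<le> \<delta> * real n" using n \<delta>(1) by (intro mult_left_mono) auto
  then have \<delta>1: "2 * \<delta> \<le> 1" using n\<delta> by (simp add: mult.commute)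
  have st: "\<exists>y. v + y \<in> Y \<and> c \<le> norm y \<and> norm y \<le> 2 / a \<and> norm (P m y) \<le> \<delta> \<and> R (Suc k) (v + y)"
    if v: "v \<in> Y" "R k v" for k v m
  proof -
    obtain S where S: "compact S" "\<And>x. norm x \<le> 1 / a \<Longrightarrow> P m x \<in> S" using P_compact by blast
    have PS: "P m x \<in> S" if "x \<in> Y" "N x \<le> 1" for x
      using order_trans[OF ab(3)[OF that(1)] that(2)] ab(1) by (intro S(2)) (simp add: le_divide_eq mult.commute)
    obtain y where y: "y \<in> Y" "1/8 \<le> N y" "N y \<le> 2" "norm (P m y) \<le> \<delta>" "R (Suc k) (v + y)"
      using step[rule_format, OF S(1) PS P_diff v(1) \<delta>(1) v(2)] by blast
    have "1/8 \<le> b * norm y" using y(2) ab(4)[OF y(1)] by linarith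
    then have "c \<le> norm y" using ab(2) by (simp add: c_def divide_le_eq mult_ac)
    moreover have "norm y \<le> 2 / a"
      using order_trans[OF ab(3)[OF y(1)] y(3)] ab(1) by (simp add: le_divide_eq mult.commute)
    ultimately show ?thesis using v(1) y by (intro exI[of _ y]) auto
  qed
  obtain w x where w: "w \<in> Y" "R n w" and d: "norm ((\<Sum>k=1..n. x k) - w) \<le> 2 * real n * \<delta>"
    and x: "\<forall>k. 1 \<le> k \<longrightarrow> k \<le> n \<longrightarrow> c / 2 \<le> norm (x k) \<and> norm (x k) \<le> 2 / a + 2 * \<delta>"
    and bl: "\<forall>k. 1 \<le> k \<longrightarrow> k < n \<longrightarrow> block_less smul e (x k) (x (Suc k))"
    using block_sequence[where V = Y and R = R and n = n, OF \<delta>(1) Y_0 R0 st \<delta>(2)] by blast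
  have "\<bar>norm (\<Sum>k=1..n. x k) - norm w\<bar> \<le> 1"
    using norm_triangle_ineq3[of "\<Sum>k=1..n. x k" w] d n\<delta> by linarith
  moreover have "1 / (16 * b) \<le> norm (x k) \<and> norm (x k) \<le> 2 / a + 1" if k: "1 \<le> k" "k \<le> n" for k
  proof
    have "c / 2 = 1 / (16 * b)" by (simp add: c_def)
    then show "1 / (16 * b) \<le> norm (x k)" using x k by metis
    have "norm (x k) \<le> 2 / a + 2 * \<delta>" using x k by blast
    then show "norm (x k) \<le> 2 / a + 1" using \<delta>1 by linarith
  qed
  ultimately show ?thesis using w bl by blast
qed

lemma norm_equivalence:
  obtains a b where "0 < a" "0 < b" "\<And>y. y \<in> Y \<Longrightarrow> a * norm y \<le> N y" "\<And>y. y \<in> Y \<Longrightarrow> N y \<le> b * norm y"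
  using N unfolding equivalent_norm_on_def by blast

text \<open>Increments of \<open>(N v)^2\<close> by 1/64 give norms of order at least n^(1/2), while
  the upper estimate for bounded blocks allows only order n^(1/q); comparing exponents gives 1/2
  \<le> 1/q.\<close>

lemma q_le_2: "q \<le> 2"
proof -
  obtain a b where ab: "0 < a" "0 < b" "\<And>y. y \<in> Y \<Longrightarrow> a * norm y \<le> N y" "\<And>y. y \<in> Y \<Longrightarrow> N y \<le> b * norm y"
    by (rule norm_equivalence) blast
  define c where "c = 2 / a + 1"
  have c: "0 < c" using ab by (simp add: c_def add_pos_pos)
  have "real n powr (1/2) \<le> (8 * b * (C * c + 1)) * real n powr (1 / q)" if n: "1 \<le> n" for n :: nat
  proof -
    let ?R = "\<lambda>k v. real k / 64 \<le> (N v)\<^sup>2"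
    have R0: "?R 0 0" by simp
    have step: "\<forall>S P k v \<delta>. compact S \<longrightarrow> (\<forall>x\<in>Y. N x \<le> 1 \<longrightarrow> P x \<in> S) \<longrightarrow>
      (\<forall>x\<in>Y. \<forall>y\<in>Y. P (x - y) = P x - P y) \<longrightarrow> v \<in> Y \<longrightarrow> 0 < \<delta> \<longrightarrow> ?R k v \<longrightarrow>
      (\<exists>y\<in>Y. 1/8 \<le> N y \<and> N y \<le> 2 \<and> norm (P y :: 'a) \<le> \<delta> \<and> ?R (Suc k) (v + y))"
    proof (intro allI impI)
      fix S and P :: "'a \<Rightarrow> 'a" and k v and \<delta> :: real
      assume "compact S" "\<forall>x\<in>Y. N x \<le> 1 \<longrightarrow> P x \<in> S" "\<forall>x\<in>Y. \<forall>y\<in>Y. P (x - y) = P x - P y"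
        "v \<in> Y" "0 < \<delta>" "?R k v"
      note h = this[rule_format]
      obtain y where y: "y \<in> Y" "1/8 \<le> N y" "N y \<le> 2" "norm (P y) \<le> \<delta>" "(N v)\<^sup>2 + 1/64 \<le> (N (v + y))\<^sup>2"
        using step_lower[of P S v \<delta>, OF h(3,1,2,4,5)] by blast
      have "real (Suc k) / 64 \<le> (N (v + y))\<^sup>2" using y(5) h(6) by simp
      then show "\<exists>y\<in>Y. 1/8 \<le> N y \<and> N y \<le> 2 \<and> norm (P y) \<le> \<delta> \<and> ?R (Suc k) (v + y)"
        using y by blast
    qed
    obtain w x where w: "w \<in> Y" "real n / 64 \<le> (N w)\<^sup>2"
      and d: "\<bar>norm (\<Sum>k=1..n. x k) - norm w\<bar> \<le> 1"
      and x: "\<And>k. 1 \<le> k \<Longrightarrow> k \<le> n \<Longrightarrow> norm (x k) \<le> 2 / a + 1"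
      and bl: "\<And>k. 1 \<le> k \<Longrightarrow> k < n \<Longrightarrow> block_less smul e (x k) (x (Suc k))"
      using block_sequence_in_Y[where R = ?R, OF ab n R0 step] by blast
    have "sqrt (real n / 64) \<le> sqrt ((N w)\<^sup>2)" using w(2) by (rule real_sqrt_le_mono)
    then have "real n powr (1/2) / 8 \<le> N w" using w(1) by (simp add: real_sqrt_divide powr_half_sqrt)
    also have "\<dots> \<le> b * norm w" by (rule ab(4)[OF w(1)])
    finally have 1: "real n powr (1/2) \<le> 8 * b * norm w" by simp
    have "norm (\<Sum>k=1..n. x k) \<le> C * (\<Sum>k=1..n. norm (x k) powr q) powr (1 / q)"
      using bl by (rule upper_est)
    also have "\<dots> \<le> C * (\<Sum>k=1..n. c powr q) powr (1 / q)"
      using C_pos q_pos x by (intro mult_left_mono powr_mono2 sum_mono sum_nonneg) (auto simp: c_def)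
    also have "(\<Sum>k=1..n. c powr q) powr (1 / q) = real n powr (1 / q) * c"
      using q_pos c by (simp add: powr_mult powr_powr)
    finally have 2: "norm (\<Sum>k=1..n. x k) \<le> C * (real n powr (1 / q) * c)" .
    \<comment> \<open>Absorbs the deviation 1 between the block sum and \<open>w\<close> into the
      power of \<open>n\<close>.\<close>
    have "real 1 powr (1 / q) \<le> real n powr (1 / q)" using n q_pos by (intro powr_mono2) auto
    then have "norm w \<le> C * (real n powr (1 / q) * c) + real n powr (1 / q)"
      using d 2 by simp
    also have "\<dots> = (C * c + 1) * real n powr (1 / q)" by (simp add: algebra_simps)
    finally have "8 * b * norm w \<le> 8 * b * ((C * c + 1) * real n powr (1 / q))"
      using ab by (intro mult_left_mono) auto
    with 1 show ?thesis by (simp only: mult.assoc)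
  qed
  then have "1/2 \<le> 1 / q" by (rule powr_bound_imp_exponent_le)
  then show ?thesis using q_pos by (simp add: field_simps)
qed

text \<open>Increments of \<open>(N v)^2\<close> by at most 4 keep the norms of order n^(1/2), while
  blocks bounded away from 0 force order n^(1/p) through the lower estimate; hence 1/p \<le>
  1/2.\<close>

lemma p_ge_2: "2 \<le> p"
proof -
  obtain a b where ab: "0 < a" "0 < b" "\<And>y. y \<in> Y \<Longrightarrow> a * norm y \<le> N y" "\<And>y. y \<in> Y \<Longrightarrow> N y \<le> b * norm y"
    by (rule norm_equivalence) blast
  define c where "c = 1 / (16 * b)"
  have c: "0 < c" using ab by (simp add: c_def)
  have "real n powr (1 / p) \<le> (C / c * (2 / a + 1)) * real n powr (1/2)" if n: "1 \<le> n" for n :: nat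
  proof -
    let ?R = "\<lambda>k v. (N v)\<^sup>2 \<le> 4 * real k"
    have R0: "?R 0 0" using N_eq_0[of 0] by simp
    have step: "\<forall>S P k v \<delta>. compact S \<longrightarrow> (\<forall>x\<in>Y. N x \<le> 1 \<longrightarrow> P x \<in> S) \<longrightarrow>
      (\<forall>x\<in>Y. \<forall>y\<in>Y. P (x - y) = P x - P y) \<longrightarrow> v \<in> Y \<longrightarrow> 0 < \<delta> \<longrightarrow> ?R k v \<longrightarrow>
      (\<exists>y\<in>Y. 1/8 \<le> N y \<and> N y \<le> 2 \<and> norm (P y :: 'a) \<le> \<delta> \<and> ?R (Suc k) (v + y))"
    proof (intro allI impI)
      fix S and P :: "'a \<Rightarrow> 'a" and k v and \<delta> :: real
      assume "compact S" "\<forall>x\<in>Y. N x \<le> 1 \<longrightarrow> P x \<in> S" "\<forall>x\<in>Y. \<forall>y\<in>Y. P (x - y) = P x - P y"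
        "v \<in> Y" "0 < \<delta>" "?R k v"
      note h = this[rule_format]
      obtain y where y: "y \<in> Y" "1/8 \<le> N y" "N y \<le> 2" "norm (P y) \<le> \<delta>" "(N (v + y))\<^sup>2 \<le> (N v)\<^sup>2 + 4"
        using step_upper[of P S v \<delta>, OF h(3,1,2,4,5)] by blast
      have "(N (v + y))\<^sup>2 \<le> 4 * real (Suc k)" using y(5) h(6) by simp
      then show "\<exists>y\<in>Y. 1/8 \<le> N y \<and> N y \<le> 2 \<and> norm (P y) \<le> \<delta> \<and> ?R (Suc k) (v + y)"
        using y by blast
    qed
    obtain w x where w: "w \<in> Y" "(N w)\<^sup>2 \<le> 4 * real n"
      and d: "\<bar>norm (\<Sum>k=1..n. x k) - norm w\<bar> \<le> 1"
      and x: "\<And>k. 1 \<le> k \<Longrightarrow> k \<le> n \<Longrightarrow> 1 / (16 * b) \<le> norm (x k)"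
      and bl: "\<And>k. 1 \<le> k \<Longrightarrow> k < n \<Longrightarrow> block_less smul e (x k) (x (Suc k))"
      using block_sequence_in_Y[where R = ?R, OF ab n R0 step] by blast
    have "sqrt ((N w)\<^sup>2) \<le> sqrt (4 * real n)" using w(2) by (rule real_sqrt_le_mono)
    then have "N w \<le> 2 * real n powr (1/2)" using w(1) by (simp add: real_sqrt_mult powr_half_sqrt)
    then have "a * norm w \<le> 2 * real n powr (1/2)" using ab(3)[OF w(1)] by linarith
    then have "norm w \<le> 2 / a * real n powr (1/2)" using ab(1) by (simp add: field_simps)
    moreover have "real 1 powr (1/2) \<le> real n powr (1/2)" using n by (intro powr_mono2) auto
    ultimately have 1: "norm (\<Sum>k=1..n. x k) \<le> (2 / a + 1) * real n powr (1/2)"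
      using d by (simp add: distrib_right)
    have "real n powr (1 / p) * c = (\<Sum>k=1..n. c powr p) powr (1 / p)"
      using p_pos c by (simp add: powr_mult powr_powr)
    also have "\<dots> \<le> (\<Sum>k=1..n. norm (x k) powr p) powr (1 / p)"
      using p_pos x c by (intro powr_mono2 sum_mono sum_nonneg) (auto simp: c_def)
    finally have "1 / C * (real n powr (1 / p) * c) \<le> 1 / C * (\<Sum>k=1..n. norm (x k) powr p) powr (1 / p)"
      using C_pos by (intro mult_left_mono) auto
    also have "\<dots> \<le> norm (\<Sum>k=1..n. x k)"
      using bl by (rule lower_est)
    also note 1
    finally show ?thesis using C_pos c by (simp add: field_simps)
  qed
  then have "1 / p \<le> 1/2" by (rule powr_bound_imp_exponent_le)
  then show ?thesis using p_pos by (simp add: field_simps)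
qed

end

theorem corollary2p15:
  fixes smul :: "'k::{real_normed_field,banach} \<Rightarrow> 'a::banach \<Rightarrow> 'a"
    and e :: "nat \<Rightarrow> 'a" and Y :: "'a set" and N :: "'a \<Rightarrow> real" and p q :: real
  assumes "banach_space_over smul"
    and "schauder_basis smul e"
    and "closed_infdim_subspace smul Y"
    and "equivalent_norm_on smul Y N"
    and "almost_transitive smul Y N"
    and "1 < q" and "q \<le> p"
    and "pq_estimates smul e p q"
  shows "q \<le> 2 \<and> 2 \<le> p"
proof -
  obtain C where C: "0 < C" and est: "\<And>n x. (\<forall>k\<in>{1..<n}. block_less smul e (x k) (x (Suc k))) \<Longrightarrow>
      1 / C * (\<Sum>k=1..n. norm (x k) powr p) powr (1 / p) \<le> norm (\<Sum>k=1..n. x k) \<and>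
      norm (\<Sum>k=1..n. x k) \<le> C * (\<Sum>k=1..n. norm (x k) powr q) powr (1 / q)"
    using assms(8) unfolding pq_estimates_def by blast
  interpret banach_space_over smul by fact
  interpret transitive_in_pq smul e p q C Y N
  proof
    show "schauder_basis smul e" "closed_infdim_subspace smul Y" "equivalent_norm_on smul Y N"
      "almost_transitive smul Y N" "0 < p" "0 < q" "0 < C"
      using assms C by auto
    fix n :: nat and x :: "nat \<Rightarrow> 'a"
    assume "\<And>k. 1 \<le> k \<Longrightarrow> k < n \<Longrightarrow> block_less smul e (x k) (x (Suc k))"
    then have "\<forall>k\<in>{1..<n}. block_less smul e (x k) (x (Suc k))" by simp
    from est[OF this]
    show "1 / C * (\<Sum>k=1..n. norm (x k) powr p) powr (1 / p) \<le> norm (\<Sum>k=1..n. x k)"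
      and "norm (\<Sum>k=1..n. x k) \<le> C * (\<Sum>k=1..n. norm (x k) powr q) powr (1 / q)" by auto
  qed
  show ?thesis using q_le_2 p_ge_2 by blast
qed

end
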